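(* In the codimension-one setting described in the context, let $\beta\in V_{\mathbb{C}}$, $u\in\mathbb{Z}A$, and let $\ell^{(u)}\in\mathbb{Z}^n$ be such that $\sum_{\sigma=1}^n\ell^{(u)}_\sigma\mathbf{a}_\sigma=u$. Suppose that each $v\in E'_\beta$ has minimal $(I,u)$-negative support for all $I\subseteq\{1,\dots,n\}$ with $|I|\ge n-(m_v-1)$, and suppose that each $\Phi^\emptyset_{v,\beta+u}(x)$, $v\in E'_\beta$, is nonzero. Then the series $$S_{v,u,r}(x):=\sum_{s=0}^r\ \sum_{1\le t_1<\dots<t_s\le r}\ \sum_{p_{t_1},\dots,p_{t_s}=1}^n\Big(\prod_{a=1}^s\epsilon_{p_{t_a}}\ell_{p_{t_a}}\Big)\,\Phi^{(p_{t_1},\dots,p_{t_s})}_{v,\beta+u}(x)\,\log^{r-s}x_0\qquad(v\in E'_\beta,\ 0\le r\le m_v-1)$$ (where $\ell_p$ denotes the positive integer coefficient in the relation on $A$) form a set of $\sum_{i=1}^k\ell_i$ linearly independent solutions of the $A$-hypergeometric system with parameter $\beta+u$ that lie in the Nilsson ring $\mathbb{C}[[x_0]][x_0^{-1},\log x_0,\{x^v\}_{v\in E'_\beta}]$.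
   Context: Setting: $A=\{\mathbf{a}_1,\dots,\mathbf{a}_n\}\subseteq\mathbb{Z}^d$, $V\subseteq\mathbb{R}^d$ is the real span of $A$, $V_{\mathbb{C}}\subseteq\mathbb{C}^d$ its complex span, $\mathbb{Z}A$ the abelian group generated by $A$. It is assumed that $\dim V=n-1$ and that each subset of $A$ of cardinality $n-1$ is linearly independent. The lattice of integer relations on $A$ is generated by a single relation $\sum_{i=1}^k \ell_i\mathbf{a}_i-\sum_{j=k+1}^n\ell_j\mathbf{a}_j=\mathbf{0}$, where $1\le k\le n$ and $\ell_1,\dots,\ell_n$ are relatively prime positive integers. Put $\epsilon_p=1$ for $1\le p\le k$ and $\epsilon_p=-1$ for $k+1\le p\le n$; $\ell=(\ell_1,\dots,\ell_k,-\ell_{k+1},\dots,-\ell_n)$; $L=\mathbb{Z}\ell$; $x_0=\prod_{i=1}^kx_i^{\ell_i}/\prod_{j=k+1}^nx_j^{\ell_j}$; and $x^w=\prod_\mu x_\mu^{w_\mu}$ for $w\in\mathbb{C}^n$. The $A$-hypergeometric system with parameter $\gamma=(\gamma_1,\dots,\gamma_d)$ consists of the box operators $\Box_l=\prod_{l_j>0}\partial_j^{l_j}-\prod_{l_j<0}\partial_j^{-l_j}$ for $l\in L$, and the Euler operators $\sum_{j=1}^n a_{ij}x_j\partial_j-\gamma_i$ for $i=1,\dots,d$, where $\mathbf{a}_j=(a_{1j},\dots,a_{dj})$. Operators act on formal series termwise. Exponents: for $i\in\{1,\dots,k\}$, $b\in\{0,\dots,\ell_i-1\}$, $v^{(i,b)}\in\mathbb{C}^n$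 is the unique vector with $v^{(i,b)}_i=b$ and $\sum_\mu v^{(i,b)}_\mu\mathbf{a}_\mu=\beta$. $E_\beta$ is the set of all $v^{(i,b)}$; $E'_\beta=\{v\in E_\beta\mid v_i\notin\mathbb{Z}_{<0}\text{ for }i=1,\dots,k\}$; for $v\in E'_\beta$, $M_v=\{i\in\{1,\dots,k\}\mid v_i\in\mathbb{Z}_{\ge0}\}$ and $m_v=|M_v|$. Negative supports: $L(u)=\{l\in\mathbb{Z}^n\mid\sum_jl_j\mathbf{a}_j=u\}$; for $I\subseteq\{1,\dots,n\}$, $I\text{-nsupp}(w)=\{i\in I\mid w_i\in\mathbb{Z}_{<0}\}$; $v$ has minimal $(I,u)$-negative support if $I\text{-nsupp}(v+l)$ is not a proper subset of $I\text{-nsupp}(v)$ for any $l\in L(u)$. Put $\mathbb{Z}_{v,I}(u,\ell^{(u)})=\{z\in\mathbb{Z}\mid I\text{-nsupp}(v+\ell^{(u)}+z\ell)=I\text{-nsupp}(v)\}$. Constants $M_{l,s}(c)$ ($c\in\mathbb{C}$, $l\in\mathbb{Z}$, $s\in\mathbb{Z}_{\ge0}$): $M_{0,0}(c)=1$ and $M_{0,s}(c)=0$ for $s>0$; for $l>0$ (and $c+l<0$ if $c\in\mathbb{Z}_{<0}$), $M_{l,s}(c)=\frac{(-1)^s}{(c+1)\cdots(c+l)}\sum_{i_1+\cdots+i_l=s}\frac1{(c+1)^{i_1}}\cdots\frac1{(c+l)^{i_l}}$ (sum over nonnegative integers $i_1,\dots,i_l$); for $l<0$, $M_{l,s}(c)=S^{(-l)}_{-l-s}(c,c-1,\dots,c+l+1)$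 if $s\le-l$ and $0$ if $s>-l$, where $S^{(\sigma)}_\tau$ is the elementary symmetric polynomial of degree $\tau$ in $\sigma$ variables. For a finite sequence $Q$ from $\{1,\dots,n\}$ let $\rho_Q(i)$ be the number of times $i$ occurs in $Q$, $\bar Q=\{i\mid\rho_Q(i)>0\}$, $\bar Q^{\rm c}$ its complement in $\{1,\dots,n\}$, and $$\Phi^Q_{v,\beta+u}(x)=x^{v+\ell^{(u)}}\sum_{z\in\mathbb{Z}_{v,\bar Q^{\rm c}}(u,\ell^{(u)})}\Big(\prod_{i=1}^kM_{\ell^{(u)}_i+z\ell_i,\rho_Q(i)}(v_i)\prod_{j=k+1}^nM_{\ell^{(u)}_j-z\ell_j,\rho_Q(j)}(v_j)\Big)x_0^z .$$ (This is independent of the choice of $\ell^{(u)}$. $\Phi^\emptyset_{v,\beta+u}$ is the case of the empty sequence; the $s=0$ term in $S_{v,u,r}$ is $\Phi^\emptyset_{v,\beta+u}(x)\log^rx_0$.)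
   Formalization: Φ^Q carries an extra factor ∏ρ_Q(i)! (equal to 1 if Q has no repeated index), needed for r≥2; membership is shown in the Nilsson ring with E'_{β+u} in place of E'_β, and in x^{ℓ^(u)} times the ring with E'_β, since the printed formula and membership fail in general. *)

theory Defs
  imports
    "HOL-Analysis.Analysis"
    "HOL-Library.Function_Algebras"
    "HOL-Library.FuncSet"
    "HOL-Computational_Algebra.Formal_Power_Series"
begin

section \<open>The configuration of points\<close>

text \<open>
  Vectors indexed by \<open>1, \<dots>, n\<close> are functions on \<^typ>\<open>nat\<close> that vanish outside \<open>{1..n}\<close>.
  The points are \<open>a 1, \<dots>, a n\<close>, and the ambient dimension is \<open>CARD('d)\<close>.
\<close>

definition coords :: "nat \<Rightarrow> (nat \<Rightarrow> 'b::zero) set" where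
  "coords n = {w. \<forall>j. j \<notin> {1..n} \<longrightarrow> w j = 0}"

definition ovec :: "int ^ 'd \<Rightarrow> 'b::ring_1 ^ 'd" where
  "ovec x = (\<chi> i. of_int (x $ i))"

definition comb :: "nat \<Rightarrow> (nat \<Rightarrow> int ^ 'd) \<Rightarrow> (nat \<Rightarrow> 'b::comm_ring_1) \<Rightarrow> 'b ^ 'd" where
  "comb n a w = (\<Sum>j = 1..n. w j *s ovec (a j))"

definition eps :: "nat \<Rightarrow> nat \<Rightarrow> int" where
  "eps k p = (if p \<le> k then 1 else - 1)"

text \<open>\<open>l\<close> lists the positive integers of the relation; \<open>ell\<close> is the signed vector.\<close>

definition ell :: "nat \<Rightarrow> nat \<Rightarrow> (nat \<Rightarrow> nat) \<Rightarrow> nat \<Rightarrow> int" where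
  "ell n k l p = (if p \<in> {1..n} then eps k p * int (l p) else 0)"

definition rel_lattice :: "nat \<Rightarrow> nat \<Rightarrow> (nat \<Rightarrow> nat) \<Rightarrow> (nat \<Rightarrow> int) set" where
  "rel_lattice n k l = {\<lambda>p. z * ell n k l p | z. True}"

definition fibre :: "nat \<Rightarrow> (nat \<Rightarrow> int ^ 'd) \<Rightarrow> int ^ 'd \<Rightarrow> (nat \<Rightarrow> int) set" where
  "fibre n a u = {z \<in> coords n. comb n a z = u}"

definition codim_one ::
    "nat \<Rightarrow> nat \<Rightarrow> (nat \<Rightarrow> int ^ 'd) \<Rightarrow> (nat \<Rightarrow> nat) \<Rightarrow> bool" where
  "codim_one n k a l \<longleftrightarrow>
     1 \<le> k \<and> k \<le> n \<and> inj_on a {1..n} \<and>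
     dim (span (ovec ` a ` {1..n} :: (real ^ 'd) set)) = n - 1 \<and>
     (\<forall>B \<subseteq> (ovec ` a ` {1..n} :: (real ^ 'd) set). card B = n - 1 \<longrightarrow> independent B) \<and>
     (\<forall>p \<in> {1..n}. 0 < l p) \<and> Gcd (l ` {1..n}) = 1 \<and>
     fibre n a 0 = rel_lattice n k l"


section \<open>Exponents and negative supports\<close>

definition neg_ints :: "complex set" where
  "neg_ints = of_int ` {..<0}"

definition exponent ::
    "nat \<Rightarrow> (nat \<Rightarrow> int ^ 'd) \<Rightarrow> complex ^ 'd \<Rightarrow> nat \<Rightarrow> nat \<Rightarrow> nat \<Rightarrow> complex" where
  "exponent n a \<beta> i b = (THE v. v \<in> coords n \<and> v i = of_nat b \<and> comb n a v = \<beta>)"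

definition exponents ::
    "nat \<Rightarrow> nat \<Rightarrow> (nat \<Rightarrow> int ^ 'd) \<Rightarrow> (nat \<Rightarrow> nat) \<Rightarrow> complex ^ 'd \<Rightarrow> (nat \<Rightarrow> complex) set" where
  "exponents n k a l \<beta> = {exponent n a \<beta> i b | i b. i \<in> {1..k} \<and> b < l i}"

definition exponents' ::
    "nat \<Rightarrow> nat \<Rightarrow> (nat \<Rightarrow> int ^ 'd) \<Rightarrow> (nat \<Rightarrow> nat) \<Rightarrow> complex ^ 'd \<Rightarrow> (nat \<Rightarrow> complex) set" where
  "exponents' n k a l \<beta> = {v \<in> exponents n k a l \<beta>. \<forall>i \<in> {1..k}. v i \<notin> neg_ints}"

text \<open>The number $m_v$.\<close>

definition log_mult :: "nat \<Rightarrow> (nat \<Rightarrow> complex) \<Rightarrow> nat" where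
  "log_mult k v = card {i \<in> {1..k}. v i \<in> \<nat>}"

definition nsupp :: "nat set \<Rightarrow> (nat \<Rightarrow> complex) \<Rightarrow> nat set" where
  "nsupp I w = {i \<in> I. w i \<in> neg_ints}"

definition min_nsupp ::
    "nat \<Rightarrow> (nat \<Rightarrow> int ^ 'd) \<Rightarrow> nat set \<Rightarrow> int ^ 'd \<Rightarrow> (nat \<Rightarrow> complex) \<Rightarrow> bool" where
  "min_nsupp n a I u v \<longleftrightarrow>
     (\<forall>z \<in> fibre n a u. \<not> nsupp I (\<lambda>j. v j + of_int (z j)) \<subset> nsupp I v)"

text \<open>\<open>shift n k l lu v z\<close> is the exponent vector of \<open>x\<^bsup>v + lu\<^esup> x\<^sub>0\<^bsup>z\<^esup>\<close>.\<close>

definition shift ::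
    "nat \<Rightarrow> nat \<Rightarrow> (nat \<Rightarrow> nat) \<Rightarrow> (nat \<Rightarrow> int) \<Rightarrow> (nat \<Rightarrow> complex) \<Rightarrow> int \<Rightarrow> nat \<Rightarrow> complex" where
  "shift n k l lu v z = (\<lambda>j. v j + of_int (lu j + z * ell n k l j))"

definition zset ::
    "nat \<Rightarrow> nat \<Rightarrow> (nat \<Rightarrow> nat) \<Rightarrow> (nat \<Rightarrow> int) \<Rightarrow> (nat \<Rightarrow> complex) \<Rightarrow> nat set \<Rightarrow> int set" where
  "zset n k l lu v I = {z. nsupp I (shift n k l lu v z) = nsupp I v}"


section \<open>The constants $M_{l,s}(c)$\<close>

text \<open>Elementary symmetric polynomial of degree \<open>t\<close> in \<open>y 0, \<dots>, y (s - 1)\<close>.\<close>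

definition esym :: "nat \<Rightarrow> nat \<Rightarrow> (nat \<Rightarrow> complex) \<Rightarrow> complex" where
  "esym s t y = (\<Sum>J | J \<subseteq> {..<s} \<and> card J = t. \<Prod>j\<in>J. y j)"

text \<open>
  For \<open>l > 0\<close> and \<open>c \<in> {-l..-1}\<close> the constant is not defined mathematically (division by zero).
  These values do not occur in \<open>Phi\<close> below when \<open>v\<close> satisfies the minimality conditions
  under which the series are used.
\<close>

definition Mconst :: "int \<Rightarrow> nat \<Rightarrow> complex \<Rightarrow> complex" where
  "Mconst l s c =
     (if l = 0 then (if s = 0 then 1 else 0)
      else if l > 0 then
        (- 1) ^ s / (\<Prod>j = 1..nat l. c + of_nat j) *
        (\<Sum>i | i \<in> {1..nat l} \<rightarrow>\<^sub>E UNIV \<and> (\<Sum>j = 1..nat l. i j) = s.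
            \<Prod>j = 1..nat l. 1 / (c + of_nat j) ^ (i j))
      else if s \<le> nat (- l) then esym (nat (- l)) (nat (- l) - s) (\<lambda>j. c - of_nat j)
      else 0)"


section \<open>Formal logarithmic series\<close>

text \<open>
  \<open>f w q\<close> is the coefficient of \<open>x\<^sup>w (log x\<^sub>0)\<^sup>q\<close> in the formal series \<open>f\<close>, where
  \<open>x\<^sub>0 = x\<^bsup>ell\<^esup>\<close>.
  Addition is the pointwise one; the product is \<open>smul\<close> below.
\<close>

type_synonym ser = "(nat \<Rightarrow> complex) \<Rightarrow> nat \<Rightarrow> complex"

definition sscale :: "complex \<Rightarrow> ser \<Rightarrow> ser" where
  "sscale c f = (\<lambda>w q. c * f w q)"

interpretation ser: vector_space sscale
  by unfold_locales (auto simp: sscale_def fun_eq_iff algebra_simps)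

text \<open>\<open>mon w q\<close> is \<open>x\<^sup>w (log x\<^sub>0)\<^sup>q\<close>.\<close>

definition mon :: "(nat \<Rightarrow> complex) \<Rightarrow> nat \<Rightarrow> ser" where
  "mon w q = (\<lambda>w' q'. if w' = w \<and> q' = q then 1 else 0)"

text \<open>
  The Cauchy product. It is meaningful when all the sums below have finitely many nonzero terms,
  as is the case for any two series with exponents in finitely many sets
  \<open>w + {0, ell, 2 ell, \<dots>}\<close> and bounded powers of \<open>log x\<^sub>0\<close>; in particular on all of
  the Nilsson ring below.
\<close>

definition smul :: "ser \<Rightarrow> ser \<Rightarrow> ser" where
  "smul f g = (\<lambda>w q.
     \<Sum>(w1, q1) | q1 \<le> q \<and> f w1 q1 \<noteq> 0 \<and> g (w - w1) (q - q1) \<noteq> 0.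
       f w1 q1 * g (w - w1) (q - q1))"

definition x0_fps :: "nat \<Rightarrow> nat \<Rightarrow> (nat \<Rightarrow> nat) \<Rightarrow> complex fps \<Rightarrow> ser" where
  "x0_fps n k l F = (\<lambda>w q. if q = 0
     then \<Sum>m | w = (\<lambda>j. of_nat m * of_int (ell n k l j)). fps_nth F m else 0)"

text \<open>
  The ring generated over $\mathbb{C}[[x_0]]$ by $x_0^{-1}$, $\log x_0$ and $x^v$, $v \in E$.
  If all \<open>v \<in> E\<close> have \<open>comb n a v = \<beta>\<close>, then every exponent \<open>w\<close> occurring in it has
  \<open>comb n a w\<close> equal to a natural multiple of \<open>\<beta>\<close>. A series of weight \<open>\<beta> + u\<close> can therefore
  lie in it only for \<open>E\<close> of that weight, or after division by a monomial of weight \<open>u\<close>.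
\<close>

inductive_set nilsson ::
    "nat \<Rightarrow> nat \<Rightarrow> (nat \<Rightarrow> nat) \<Rightarrow> (nat \<Rightarrow> complex) set \<Rightarrow> ser set"
  for n k l E where
  fps: "x0_fps n k l F \<in> nilsson n k l E"
| x0_inverse: "mon (\<lambda>j. - of_int (ell n k l j)) 0 \<in> nilsson n k l E"
| log_x0: "mon (\<lambda>_. 0) 1 \<in> nilsson n k l E"
| exponent: "v \<in> E \<Longrightarrow> mon v 0 \<in> nilsson n k l E"
| add: "f \<in> nilsson n k l E \<Longrightarrow> g \<in> nilsson n k l E \<Longrightarrow> f + g \<in> nilsson n k l E"
| mult: "f \<in> nilsson n k l E \<Longrightarrow> g \<in> nilsson n k l E \<Longrightarrow> smul f g \<in> nilsson n k l E"


section \<open>The hypergeometric system\<close>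

text \<open>
  Termwise differentiation, with
  \<open>\<partial>\<^sub>j (x\<^sup>w (log x\<^sub>0)\<^sup>q) = w\<^sub>j x\<^bsup>w - e\<^esup> (log x\<^sub>0)\<^sup>q + q ell\<^sub>j x\<^bsup>w - e\<^esup> (log x\<^sub>0)\<^bsup>q - 1\<^esup>\<close>
  for the \<open>j\<close>-th unit vector \<open>e\<close>, since \<open>\<partial>\<^sub>j log x\<^sub>0 = ell\<^sub>j / x\<^sub>j\<close>; see \<open>pderiv_mon\<close>.
\<close>

definition pderiv_ser :: "nat \<Rightarrow> nat \<Rightarrow> (nat \<Rightarrow> nat) \<Rightarrow> nat \<Rightarrow> ser \<Rightarrow> ser" where
  "pderiv_ser n k l j f = (\<lambda>w q.
     (w j + 1) * f (w(j := w j + 1)) q +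
     of_nat (q + 1) * of_int (ell n k l j) * f (w(j := w j + 1)) (q + 1))"

lemma pderiv_mon:
  "pderiv_ser n k l j (mon w q) =
     sscale (w j) (mon (w(j := w j - 1)) q) +
     sscale (of_nat q * of_int (ell n k l j)) (mon (w(j := w j - 1)) (q - 1))"
proof -
  have "w'(j := w' j + 1) = w \<longleftrightarrow> w' = w(j := w j - 1)" for w' :: "nat \<Rightarrow> complex"
    by (auto simp: fun_eq_iff eq_diff_eq)
  then show ?thesis
    by (intro ext) (cases q; auto simp: pderiv_ser_def mon_def sscale_def)
qed

definition times_var :: "nat \<Rightarrow> ser \<Rightarrow> ser" where
  "times_var j f = (\<lambda>w q. f (w(j := w j - 1)) q)"

definition dpower :: "nat \<Rightarrow> nat \<Rightarrow> (nat \<Rightarrow> nat) \<Rightarrow> (nat \<Rightarrow> nat) \<Rightarrow> ser \<Rightarrow> ser" where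
  "dpower n k l \<alpha> = fold (\<lambda>j. pderiv_ser n k l j ^^ \<alpha> j) [1..<Suc n]"

definition box_op :: "nat \<Rightarrow> nat \<Rightarrow> (nat \<Rightarrow> nat) \<Rightarrow> (nat \<Rightarrow> int) \<Rightarrow> ser \<Rightarrow> ser" where
  "box_op n k l z f =
     dpower n k l (\<lambda>j. nat (z j)) f - dpower n k l (\<lambda>j. nat (- z j)) f"

definition euler_op ::
    "nat \<Rightarrow> nat \<Rightarrow> (nat \<Rightarrow> int ^ 'd) \<Rightarrow> (nat \<Rightarrow> nat) \<Rightarrow> complex ^ 'd \<Rightarrow> 'd \<Rightarrow> ser \<Rightarrow> ser" where
  "euler_op n k a l \<gamma> i f =
     (\<Sum>j = 1..n. sscale (of_int (a j $ i)) (times_var j (pderiv_ser n k l j f)))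
     - sscale (\<gamma> $ i) f"

definition is_solution ::
    "nat \<Rightarrow> nat \<Rightarrow> (nat \<Rightarrow> int ^ 'd) \<Rightarrow> (nat \<Rightarrow> nat) \<Rightarrow> complex ^ 'd \<Rightarrow> ser \<Rightarrow> bool" where
  "is_solution n k a l \<gamma> f \<longleftrightarrow>
     (\<forall>z \<in> rel_lattice n k l. box_op n k l z f = 0) \<and> (\<forall>i. euler_op n k a l \<gamma> i f = 0)"


section \<open>The series $\Phi^Q$ and $S_{v,u,r}$\<close>

definition Phi_coeff ::
    "nat \<Rightarrow> nat \<Rightarrow> (nat \<Rightarrow> nat) \<Rightarrow> (nat \<Rightarrow> int) \<Rightarrow> (nat \<Rightarrow> complex) \<Rightarrow> nat list \<Rightarrow> int \<Rightarrow> complex" where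
  "Phi_coeff n k l lu v Q z =
     (\<Prod>i = 1..k. Mconst (lu i + z * int (l i)) (count_list Q i) (v i)) *
     (\<Prod>j = k + 1..n. Mconst (lu j - z * int (l j)) (count_list Q j) (v j))"

text \<open>
  The factor \<open>\<Prod>\<^sub>i (\<rho>\<^sub>Q i)!\<close> is 1 unless some index is repeated in \<open>Q\<close>.
  It is needed because \<open>Mconst m s c\<close> is the coefficient of \<open>t\<^sup>s\<close> in
  \<open>1 / ((c + t + 1) \<dots> (c + t + m))\<close> (for \<open>m < 0\<close>, in \<open>(c + t) (c + t - 1) \<dots> (c + t + m + 1)\<close>),
  whereas the \<open>s\<close>-th derivative at \<open>t = 0\<close> is what belongs next to the binomially many subsets
  summed over in \<open>S_series\<close>. Without this factor \<open>S_series\<close> with \<open>r = 2\<close> is not a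
  solution in general: for \<open>ell = (1, 1, 1, -3)\<close>, \<open>v = (0, 0, 0, -1)\<close>, \<open>u = 0\<close>, the log-free
  coefficient at \<open>z = 1\<close> would be 90, but the box operator forces 18.

  In the sum over \<open>z\<close> at most one term is present, since \<open>ell\<close> is nonzero.
\<close>

definition Phi ::
    "nat \<Rightarrow> nat \<Rightarrow> (nat \<Rightarrow> nat) \<Rightarrow> (nat \<Rightarrow> int) \<Rightarrow> (nat \<Rightarrow> complex) \<Rightarrow> nat list \<Rightarrow> ser" where
  "Phi n k l lu v Q = (\<lambda>w q. if q = 0
     then (\<Prod>i = 1..n. fact (count_list Q i)) *
       (\<Sum>z | z \<in> zset n k l lu v ({1..n} - set Q) \<and> w = shift n k l lu v z.
          Phi_coeff n k l lu v Q z)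
     else 0)"

definition S_series ::
    "nat \<Rightarrow> nat \<Rightarrow> (nat \<Rightarrow> nat) \<Rightarrow> (nat \<Rightarrow> int) \<Rightarrow> (nat \<Rightarrow> complex) \<Rightarrow> nat \<Rightarrow> ser" where
  "S_series n k l lu v r =
     (\<Sum>s = 0..r. \<Sum>T | T \<subseteq> {1..r} \<and> card T = s. \<Sum>p \<in> T \<rightarrow>\<^sub>E {1..n}.
        sscale (\<Prod>t\<in>T. of_int (eps k (p t)) * of_nat (l (p t)))
          (smul (Phi n k l lu v (map p (sorted_list_of_set T))) (mon (\<lambda>_. 0) (r - s))))"

end

theory Submission
  imports Defs
begin

text \<open>
  The proof is Frobenius' method. Let $\ell_j$ be the entries of the signed vector $\ell$. For an
  integer $m$ let $G_{j,m}(t)$ be the quotient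
  $\Gamma(v_j + \ell_j t + 1) / \Gamma(v_j + \ell_j t + m + 1)$, a product of linear factors in $t$
  or of their inverses, and put $G_{j,m} = 0$ if it has a pole at $t = 0$ (\<open>gamma_ratio\<close>). Its
  Taylor coefficients are the constants $M_{m,s}(v_j)$, up to powers of $\ell_j$. Write
  $x_0^t = \exp(t \log x_0)$ and consider the series
  $F(t) = \sum_z \bigl(\prod_j G_{j,m_j(z)}(t)\bigr) x^{v + m(z)} x_0^t$, where
  $m(z) = \ell^{(u)} + z\ell$.
  Summing over words $p$ amounts to repeated differentiation of the product over $j$
  (\<open>sum_words_fact_prod\<close>), so $S_{v,u,r}$ is $r!$ times the coefficient of $t^r$ in $F(t)$
  (\<open>S_series_eq_logser\<close>).

  The derivative $\partial_j$ multiplies $x^w x_0^t$ by $w_j + \ell_j t$, and the functional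
  equation of $\Gamma$ shows that the two halves of a box operator, applied to the terms $z$ and
  $z - b$ of $F$, agree. The poles are the obstacle: if $v_j$ is a negative integer and
  $v_j + m_j(z)$ is not, the term $z$ is absent from the series, and nothing cancels the other
  half of the box operator. Minimality of the negative supports settles this. At such a $z$ at least
  $m_v$ of the other factors vanish at $t = 0$ (\<open>many_zeros_at_pole\<close>): otherwise, deleting their
  indices would leave a large index set on which the negative support shrinks. These zeros persist
  under differentiation, so what is left uncancelled is divisible by $t^{m_v}$ and
  does not affect the coefficients of $t^r$ with $r < m_v$ (\<open>lowering_agree\<close>).

  The same factors bound the support: as $z \to -\infty$, all $m_v$ factors with $i \in M_v$ vanish
  at $t = 0$, which gives membership in the Nilsson ring (\<open>frob_coeff_bounded_below\<close>,
  \<open>logser_nilsson\<close>). Two different elements of $E'_\beta$ never differ by an integer multiple of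
  $\ell$, so the series of different $v$ have disjoint supports; for one $v$, the highest power of
  the logarithm in $S_{v,u,r}$ is $\Phi^\emptyset \log^r x_0 \neq 0$. This gives independence
  (\<open>S_series_independent\<close>). Finally, reducing $v_i$ modulo $\ell_i$ matches the pairs $(v, i)$ with
  $v \in E'_\beta$, $i \in M_v$ with the pairs $(i, b)$, $0 \le b < \ell_i$, which counts the series
  (\<open>sum_log_mult\<close>).
\<close>

section \<open>Products of linear power series\<close>

definition lin :: "complex \<Rightarrow> complex \<Rightarrow> complex fps" where
  "lin c e = fps_const c + fps_const e * fps_X"

text \<open>
  The quotient $\Gamma(c + et + 1) / \Gamma(c + et + m + 1)$ as a power series in $t$. A power series
  without constant term has inverse $0$, so the value is $0$ wherever the quotient has a pole.
\<close>

definition gamma_ratio :: "int \<Rightarrow> complex \<Rightarrow> complex \<Rightarrow> complex fps" where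
  "gamma_ratio m c e =
     (if m \<ge> 0 then \<Prod>j = 1..nat m. inverse (lin (c + of_nat j) e)
      else \<Prod>j<nat (- m). lin (c - of_nat j) e)"

lemma lin_nth: "fps_nth (lin c e) s = (if s = 0 then c else if s = 1 then e else 0)"
  by (cases s) (auto simp: lin_def fps_X_def)

lemma inverse_lin_nth: "fps_nth (inverse (lin c e)) s = (- e) ^ s / c ^ Suc s"
proof (cases "c = 0")
  case True
  have "inverse (lin c e) = 0"
    using True
    by (simp only: fps_inverse_eq_0_iff) (simp add: lin_nth)
  show ?thesis by (subst \<open>inverse (lin c e) = 0\<close>) (simp add: True)
next
  case False
  define g where "g = Abs_fps (\<lambda>s. (- e) ^ s / c ^ Suc s)"
  have "lin c e * g = 1"
  proof (rule fps_ext)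
    fix s
    show "fps_nth (lin c e * g) s = fps_nth 1 s"
      using False
      by (cases s) (simp_all add: lin_def g_def distrib_right mult.assoc)
  qed
  then have "inverse (lin c e) = g"
    using False by (metis fps_inverse_unique)
  then show ?thesis by (simp add: g_def)
qed

lemma prod_fps_nth:
  fixes F :: "'i \<Rightarrow> 'a::comm_ring_1 fps"
  assumes "finite A"
  shows "finite {i \<in> A \<rightarrow>\<^sub>E UNIV. sum i A = s} \<and>
    fps_nth (\<Prod>j\<in>A. F j) s = (\<Sum>i | i \<in> A \<rightarrow>\<^sub>E UNIV \<and> sum i A = s. \<Prod>j\<in>A. fps_nth (F j) (i j))"
  using assms
proof (induction A arbitrary: s rule: finite_induct)
  case empty
  have "{i. i \<in> {} \<rightarrow>\<^sub>E (UNIV::nat set) \<and> sum i {} = s} = (if s = 0 then {\<lambda>_. undefined} else {})"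
    by auto
  then show ?case by auto
next
  case (insert x A)
  let ?S = "\<lambda>A s. {i. i \<in> A \<rightarrow>\<^sub>E (UNIV::nat set) \<and> sum i A = s}"
  let ?J = "SIGMA y:{0..s}. ?S A (s - y)"
  have *: "sum (i(x := y)) A = sum i A" "(\<Sum>j\<in>A. if j = x then y else i j) = sum i A" for i and y :: nat
    using insert.hyps by (auto intro!: sum.cong)
  have bij: "bij_betw (\<lambda>(y, i). i(x := y)) ?J (?S (insert x A) s)"
  proof (rule bij_betw_byWitness[where f' = "\<lambda>i. (i x, i(x := undefined))"])
    show "\<forall>p\<in>?J. (\<lambda>i. (i x, i(x := undefined))) ((\<lambda>(y, i). i(x := y)) p) = p"
      using insert.hyps by (auto simp: fun_eq_iff PiE_def extensional_def)
    show "(\<lambda>i. (i x, i(x := undefined))) ` ?S (insert x A) s \<subseteq> ?J"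
      using insert.hyps by (auto simp: * PiE_def extensional_def)
  qed (use insert.hyps in \<open>auto simp: * PiE_def extensional_def\<close>)
  have "finite ?J"
    using insert.IH by auto
  then have fin: "finite (?S (insert x A) s)"
    using bij_betw_finite[OF bij] by simp
  have "fps_nth (\<Prod>j\<in>insert x A. F j) s =
      (\<Sum>y = 0..s. \<Sum>i\<in>?S A (s - y). fps_nth (F x) y * (\<Prod>j\<in>A. fps_nth (F j) (i j)))"
    using insert by (simp add: fps_mult_nth sum_distrib_left)
  also have "\<dots> = (\<Sum>(y, i)\<in>?J. fps_nth (F x) y * (\<Prod>j\<in>A. fps_nth (F j) (i j)))"
    using insert.IH by (subst sum.Sigma) auto
  also have "\<dots> = (\<Sum>i\<in>?S (insert x A) s. \<Prod>j\<in>insert x A. fps_nth (F j) (i j))"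
  proof (rule sum.reindex_bij_betw[OF bij, THEN trans[rotated], symmetric, THEN sym], rule sum.cong, simp, clarify)
    fix y i
    have "(\<Prod>j\<in>A. fps_nth (F j) (i j)) = (\<Prod>j\<in>A. fps_nth (F j) ((i(x := y)) j))"
      using insert.hyps by (intro prod.cong) auto
    then show "fps_nth (F x) y * (\<Prod>j\<in>A. fps_nth (F j) (i j)) =
        (\<Prod>j\<in>insert x A. fps_nth (F j) ((i(x := y)) j))"
      using insert.hyps by simp
  qed
  finally show ?case using fin by auto
qed

lemma fps_const_prod_eq: "fps_const (\<Prod>j\<in>A. y j) = (\<Prod>j\<in>A. fps_const (y j :: 'a::comm_ring_1))"
  by (induction A rule: infinite_finite_induct) (auto simp: fps_const_mult[symmetric] simp del: fps_const_mult)

lemma prod_lin_nth: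
  assumes "finite A"
  shows "fps_nth (\<Prod>j\<in>A. lin (y j) e) s =
    (if s \<le> card A then e ^ s * (\<Sum>J | J \<subseteq> A \<and> card J = card A - s. \<Prod>j\<in>J. y j) else 0)"
proof -
  have "(\<Prod>j\<in>A. lin (y j) e) =
      (\<Sum>J\<in>Pow A. fps_const (\<Prod>j\<in>J. y j) * (fps_const (e ^ card (A - J)) * fps_X ^ card (A - J)))"
    unfolding lin_def using assms
    by (simp add: prod_add power_mult_distrib fps_const_power fps_const_prod_eq)
  then have "fps_nth (\<Prod>j\<in>A. lin (y j) e) s =
      (\<Sum>J\<in>Pow A. if card (A - J) = s then e ^ s * (\<Prod>j\<in>J. y j) else 0)"
    by (simp only: fps_sum_nth fps_mult_left_const_nth fps_X_power_nth) (auto intro: sum.cong)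
  also have "\<dots> = (\<Sum>J | J \<subseteq> A \<and> card (A - J) = s. e ^ s * (\<Prod>j\<in>J. y j))"
    using assms by (subst sum.inter_filter[symmetric]) (auto intro: sum.cong)
  also have "{J. J \<subseteq> A \<and> card (A - J) = s} = (if s \<le> card A then {J. J \<subseteq> A \<and> card J = card A - s} else {})"
  proof -
    have "card (A - J) = card A - card J \<and> card J \<le> card A" if "J \<subseteq> A" for J
      using that assms by (simp add: card_Diff_subset card_mono finite_subset)
    then show ?thesis by (auto; metis diff_diff_cancel diff_le_self)
  qed
  finally show ?thesis
    by (auto simp: sum_distrib_left)
qed

text \<open>
  The definition of \<open>Mconst\<close> multiplies out the geometric series of the inverse factors when
  $m > 0$ and the linear factors when $m < 0$. The equation also covers the poles: there, division
  by zero makes the right-hand side $0$.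
\<close>

lemma gamma_ratio_nth: "fps_nth (gamma_ratio m c e) s = e ^ s * Mconst m s c"
proof -
  consider "m = 0" | "m > 0" | "m < 0" by linarith
  then show ?thesis
  proof cases
    case 1
    then show ?thesis by (simp add: gamma_ratio_def Mconst_def)
  next
    case 2
    let ?S = "{i. i \<in> {1..nat m} \<rightarrow>\<^sub>E UNIV \<and> sum i {1..nat m} = s}"
    have "fps_nth (gamma_ratio m c e) s = (\<Sum>i\<in>?S. \<Prod>j = 1..nat m. (- e) ^ i j / (c + of_nat j) ^ Suc (i j))"
      using 2 by (simp add: gamma_ratio_def prod_fps_nth[THEN conjunct2] inverse_lin_nth del: power_Suc)
    also have "\<dots> = (\<Sum>i\<in>?S. (- e) ^ s / (\<Prod>j = 1..nat m. c + of_nat j) *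
        (\<Prod>j = 1..nat m. 1 / (c + of_nat j) ^ i j))"
    proof (rule sum.cong[OF refl])
      fix i assume "i \<in> ?S"
      then have s: "s = sum i {1..nat m}" by simp
      show "(\<Prod>j = 1..nat m. (- e) ^ i j / (c + of_nat j) ^ Suc (i j)) =
          (- e) ^ s / (\<Prod>j = 1..nat m. c + of_nat j) * (\<Prod>j = 1..nat m. 1 / (c + of_nat j) ^ i j)"
        unfolding s power_sum by (simp add: prod_dividef prod.distrib)
    qed
    also have "\<dots> = e ^ s * Mconst m s c"
      using 2 unfolding sum_distrib_left[symmetric] by (simp add: Mconst_def power_minus[of e])
    finally show ?thesis .
  next
    case 3
    then show ?thesis
      by (simp add: gamma_ratio_def Mconst_def prod_lin_nth esym_def)
  qed
qed

lemma of_int_neg_ints_iff [simp]: "of_int i \<in> neg_ints \<longleftrightarrow> i < 0"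
  by (auto simp: neg_ints_def)

text \<open>
  The linear factors of \<open>gamma_ratio m c e\<close> have the constant terms met on the way from $c$ to
  $c + m$ by unit steps. One of them is zero precisely if this walk leaves or enters the negative integers,
  and going up it can only leave them, going down only enter.
\<close>

lemma neg_ints_crossing:
  "m \<ge> 0 \<Longrightarrow> (\<exists>j\<in>{1..nat m}. c + of_nat j = 0) \<longleftrightarrow> c \<in> neg_ints \<and> c + of_int m \<notin> neg_ints"
  "m < 0 \<Longrightarrow> (\<exists>j<nat (- m). c = of_nat j) \<longleftrightarrow> c \<notin> neg_ints \<and> c + of_int m \<in> neg_ints"
  "m \<ge> 0 \<Longrightarrow> c + of_int m \<in> neg_ints \<Longrightarrow> c \<in> neg_ints"
  "m \<le> 0 \<Longrightarrow> c \<in> neg_ints \<Longrightarrow> c + of_int m \<in> neg_ints"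
proof -
  show "(\<exists>j\<in>{1..nat m}. c + of_nat j = 0) \<longleftrightarrow> c \<in> neg_ints \<and> c + of_int m \<notin> neg_ints" if "m \<ge> 0"
  proof
    assume "\<exists>j\<in>{1..nat m}. c + of_nat j = 0"
    then obtain j where j: "j \<in> {1..nat m}" "c = of_int (- int j)"
      by (auto simp: eq_neg_iff_add_eq_0)
    then show "c \<in> neg_ints \<and> c + of_int m \<notin> neg_ints"
      unfolding j(2) of_int_add[symmetric] of_int_neg_ints_iff by auto
  next
    assume *: "c \<in> neg_ints \<and> c + of_int m \<notin> neg_ints"
    then obtain i where i: "c = of_int i" "i < 0" by (auto simp: neg_ints_def)
    with * have "i + m \<ge> 0"
      by (simp flip: of_int_add)
    with i have "nat (- i) \<in> {1..nat m}" "c + of_nat (nat (- i)) = 0" by auto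
    then show "\<exists>j\<in>{1..nat m}. c + of_nat j = 0" by blast
  qed
  show "(\<exists>j<nat (- m). c = of_nat j) \<longleftrightarrow> c \<notin> neg_ints \<and> c + of_int m \<in> neg_ints" if "m < 0"
  proof
    assume "\<exists>j<nat (- m). c = of_nat j"
    then obtain j where j: "j < nat (- m)" "c = of_int (int j)" by auto
    then show "c \<notin> neg_ints \<and> c + of_int m \<in> neg_ints"
      unfolding j(2) of_int_add[symmetric] of_int_neg_ints_iff by auto
  next
    assume *: "c \<notin> neg_ints \<and> c + of_int m \<in> neg_ints"
    then obtain i where i: "c + of_int m = of_int i" "i < 0" by (auto simp: neg_ints_def)
    then have c: "c = of_int (i - m)" by (simp add: algebra_simps)
    with * have "\<not> i - m < 0" by (simp only: of_int_neg_ints_iff) simp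
    with i c have "nat (i - m) < nat (- m)" "c = of_nat (nat (i - m))" by auto
    then show "\<exists>j<nat (- m). c = of_nat j" by blast
  qed
  show "c \<in> neg_ints" if c: "m \<ge> 0" "c + of_int m \<in> neg_ints"
  proof -
    obtain i where "c + of_int m = of_int i" "i < 0" using c(2) unfolding neg_ints_def by blast
    then have "c = of_int (i - m)" "i - m < 0" using c(1) by (auto simp: algebra_simps)
    then show ?thesis by (simp only: of_int_neg_ints_iff)
  qed
  show "c + of_int m \<in> neg_ints" if "m \<le> 0" "c \<in> neg_ints"
    using that by (auto simp: neg_ints_def simp flip: of_int_add)
qed

text \<open>
  Only the inverted factors, met on the way up, can make the series vanish identically. Hence
  \<open>gamma_ratio m c e = 0\<close> is the test for a pole.
\<close>

lemma gamma_ratio_eq_0_iff: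
  assumes "e \<noteq> 0"
  shows "gamma_ratio m c e = 0 \<longleftrightarrow> c \<in> neg_ints \<and> c + of_int m \<notin> neg_ints"
proof -
  have "lin y e \<noteq> 0" for y
    using assms lin_nth[of y e 1] by (metis fps_zero_nth one_neq_zero)
  then have "gamma_ratio m c e = 0 \<longleftrightarrow> m \<ge> 0 \<and> (\<exists>j\<in>{1..nat m}. c + of_nat j = 0)"
    by (auto simp: gamma_ratio_def lin_nth)
  also have "\<dots> \<longleftrightarrow> c \<in> neg_ints \<and> c + of_int m \<notin> neg_ints"
    using neg_ints_crossing(1)[of m c] neg_ints_crossing(4)[of m c] by (cases "m \<ge> 0") auto
  finally show ?thesis .
qed

lemma fps_prod_nth_0: "fps_nth (prod f A) 0 = (\<Prod>x\<in>A. fps_nth (f x) 0)"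
  by (induction A rule: infinite_finite_induct) auto

lemma gamma_ratio_nth_0_iff:
  "fps_nth (gamma_ratio m c e) 0 = 0 \<longleftrightarrow> (c \<in> neg_ints) \<noteq> (c + of_int m \<in> neg_ints)"
proof (cases "m \<ge> 0")
  case True
  then have "fps_nth (gamma_ratio m c e) 0 = 0 \<longleftrightarrow> (\<exists>j\<in>{1..nat m}. c + of_nat j = 0)"
    by (auto simp: gamma_ratio_def fps_prod_nth_0 lin_nth)
  with True show ?thesis
    using neg_ints_crossing(1)[of m c] neg_ints_crossing(3)[of m c] by blast
next
  case False
  then have "fps_nth (gamma_ratio m c e) 0 = 0 \<longleftrightarrow> (\<exists>j<nat (- m). c = of_nat j)"
    by (auto simp: gamma_ratio_def fps_prod_nth_0 lin_nth)
  with False show ?thesis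
    using neg_ints_crossing(2)[of m c] neg_ints_crossing(4)[of m c] by auto
qed

text \<open>
  The functional equation of $\Gamma$. It breaks down on passing from a pole to a regular point: for
  $c = -1$ and $m = 1$ the left-hand side is $0$ and the right-hand side is $1$.
\<close>

lemma lin_mult_gamma_ratio:
  assumes "gamma_ratio m c e \<noteq> 0"
  shows "lin (c + of_int m) e * gamma_ratio m c e = gamma_ratio (m - 1) c e"
proof (cases "m \<ge> 1")
  case True
  define N where "N = nat (m - 1)"
  have N: "nat m = Suc N" "m = int (Suc N)" using True by (auto simp: N_def)
  have "gamma_ratio m c e = gamma_ratio (m - 1) c e * inverse (lin (c + of_int m) e)"
    using True unfolding gamma_ratio_def N(1) by (simp add: N(2))
  with assms have "fps_nth (lin (c + of_int m) e) 0 \<noteq> 0" by auto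
  then have "inverse (lin (c + of_int m) e) * lin (c + of_int m) e = 1"
    by (rule inverse_mult_eq_1)
  then show ?thesis
    by (simp only: \<open>gamma_ratio m c e = _\<close> mult.left_commute mult.commute[of "lin _ _"] mult_1_right)
next
  case False
  define N where "N = nat (- m)"
  have N: "nat (- m) = N" "nat (1 - m) = Suc N" "m = - int N" using False by (auto simp: N_def)
  have "gamma_ratio (m - 1) c e = (\<Prod>j<Suc N. lin (c - of_nat j) e)"
    using False N(2) by (simp add: gamma_ratio_def)
  also have "\<dots> = lin (c + of_int m) e * (\<Prod>j<N. lin (c - of_nat j) e)"
    by (simp add: N(3))
  also have "(\<Prod>j<N. lin (c - of_nat j) e) = gamma_ratio m c e"
    using False by (auto simp: gamma_ratio_def N(1)) (simp add: N_def)
  finally show ?thesis ..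
qed

lemma gamma_ratio_lower_neq_0:
  assumes "gamma_ratio m c e \<noteq> 0" "e \<noteq> 0"
  shows "gamma_ratio (m - int \<alpha>) c e \<noteq> 0"
  using assms gamma_ratio_eq_0_iff[of e m c] gamma_ratio_eq_0_iff[of e "m - int \<alpha>" c]
    neg_ints_crossing(4)[of "- int \<alpha>" "c + of_int m"]
  by (auto simp: algebra_simps)

lemma prod_lin_mult_gamma_ratio:
  assumes "gamma_ratio m c e \<noteq> 0" "e \<noteq> 0"
  shows "(\<Prod>i = 1..\<alpha>. lin (c + of_int m - of_nat \<alpha> + of_nat i) e) * gamma_ratio m c e = gamma_ratio (m - int \<alpha>) c e"
proof (induction \<alpha>)
  case (Suc \<alpha>)
  have "(\<Prod>i = 1..Suc \<alpha>. lin (c + of_int m - of_nat (Suc \<alpha>) + of_nat i) e) =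
      lin (c + of_int (m - int \<alpha>)) e * (\<Prod>i = 1..\<alpha>. lin (c + of_int m - of_nat \<alpha> + of_nat i) e)"
    by (subst prod.atLeast_Suc_atMost)
      (simp_all add: One_nat_def prod.shift_bounds_cl_Suc_ivl algebra_simps del: prod.cl_ivl_Suc)
  then have "(\<Prod>i = 1..Suc \<alpha>. lin (c + of_int m - of_nat (Suc \<alpha>) + of_nat i) e) * gamma_ratio m c e =
      lin (c + of_int (m - int \<alpha>)) e * gamma_ratio (m - int \<alpha>) c e"
    by (simp only: mult.assoc Suc)
  also have "\<dots> = gamma_ratio (m - int \<alpha> - 1) c e"
    by (intro lin_mult_gamma_ratio gamma_ratio_lower_neq_0 assms)
  finally show ?case by (simp add: algebra_simps)
qed simp

lemma fps_prod_nth_eq_0: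
  assumes "finite Z" "\<And>j. j \<in> Z \<Longrightarrow> fps_nth (F j) 0 = 0" "s < card Z"
  shows "fps_nth (\<Prod>j\<in>Z. F j :: 'a::comm_ring_1 fps) s = 0"
  using assms
proof (induction Z arbitrary: s rule: finite_induct)
  case (insert x Z)
  have "fps_nth (F x) i * fps_nth (\<Prod>j\<in>Z. F j) (s - i) = 0" if "i \<le> s" for i
  proof (cases "i = 0")
    case False
    then have "s - i < card Z" using insert.hyps insert.prems that by simp
    then show ?thesis using insert.IH insert.prems by simp
  qed (use insert.prems in simp)
  then show ?case using insert.hyps by (simp add: fps_mult_nth)
qed simp

lemma fps_mult_nth_eq_0:
  assumes "\<And>i. i \<le> s \<Longrightarrow> fps_nth f i = 0"
  shows "fps_nth (f * g :: 'a::comm_ring_1 fps) s = 0"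
  using assms by (auto simp: fps_mult_nth intro!: sum.neutral)

lemma neg_ints_subset_Ints: "c \<in> neg_ints \<Longrightarrow> c \<in> \<int>"
  by (auto simp: neg_ints_def)

lemma Nats_not_neg_ints: "c \<in> \<nat> \<Longrightarrow> c \<notin> neg_ints"
  by (metis Nats_cases of_int_neg_ints_iff of_int_of_nat_eq of_nat_less_0_iff)

lemma eventually_neg_ints:
  assumes "c \<in> \<int>" "L > 0"
  shows "eventually (\<lambda>z::int. c + of_int (d + z * int L) \<in> neg_ints) at_bot"
proof -
  obtain i where i: "c = of_int i" using assms(1) Ints_cases by blast
  have "c + of_int (d + z * int L) \<in> neg_ints" if "z \<le> - 1 - \<bar>i\<bar> - \<bar>d\<bar>" for z
  proof -
    have "z * int L \<le> z * 1" using that assms(2) by (intro mult_left_mono_neg) auto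
    then show ?thesis using that unfolding i of_int_add[symmetric] of_int_neg_ints_iff by linarith
  qed
  then show ?thesis by (auto simp: eventually_at_bot_linorder)
qed

lemma eventually_not_neg_ints:
  assumes "L > 0"
  shows "eventually (\<lambda>z::int. c + of_int (z * int L) \<notin> neg_ints) at_top"
proof (cases "c \<in> \<int>")
  case True
  then obtain i where i: "c = of_int i" using Ints_cases by blast
  have "c + of_int (z * int L) \<notin> neg_ints" if "z \<ge> \<bar>i\<bar>" for z
  proof -
    have "z * int L \<ge> z * 1" using that assms by (intro mult_left_mono) auto
    then show ?thesis using that unfolding i of_int_add[symmetric] of_int_neg_ints_iff by linarith
  qed
  then show ?thesis by (auto simp: eventually_at_top_linorder)
next
  case False
  then have "c + of_int (z * int L) \<notin> neg_ints" for z
    using neg_ints_subset_Ints[of "c + of_int (z * int L)"] Ints_diff[of "c + of_int (z * int L)" "of_int (z * int L)"]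
    by auto
  then show ?thesis by simp
qed

section \<open>Sums over words\<close>

lemma fps_deriv_prod:
  fixes G :: "'i \<Rightarrow> 'a::comm_ring_1 fps"
  assumes "finite I"
  shows "fps_deriv (\<Prod>i\<in>I. G i) = (\<Sum>i\<in>I. \<Prod>j\<in>I. (G(i := fps_deriv (G i))) j)"
  using assms
proof (induction I rule: finite_induct)
  case (insert x I)
  have "(\<Prod>j\<in>I. (G(x := fps_deriv (G x))) j) = (\<Prod>j\<in>I. G j)"
    using insert.hyps by (intro prod.cong) auto
  moreover have "(\<Sum>i\<in>I. \<Prod>j\<in>insert x I. (G(i := fps_deriv (G i))) j) =
      (\<Sum>i\<in>I. G x * (\<Prod>j\<in>I. (G(i := fps_deriv (G i))) j))"
    using insert.hyps by (intro sum.cong) auto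
  ultimately show ?case
    using insert by (simp add: sum_distrib_left[symmetric] algebra_simps)
qed simp

text \<open>
  Choosing the letter $i$ at one further position replaces \<open>G i\<close> by its derivative, since
  $(c+1)!\, g_{c+1} = c!\, (c+1) g_{c+1}$. The sum over all letters is therefore the product rule,
  and words of length $s$ compute the $s$-th derivative of the product at $0$.
\<close>

lemma sum_words_fact_prod:
  fixes G :: "'i \<Rightarrow> 'a::{comm_ring_1, ring_char_0} fps"
  assumes "finite T" "finite I"
  shows "(\<Sum>p\<in>T \<rightarrow>\<^sub>E I. \<Prod>i\<in>I. fact (card {t\<in>T. p t = i}) * fps_nth (G i) (card {t\<in>T. p t = i})) =
    fact (card T) * fps_nth (\<Prod>i\<in>I. G i) (card T)"
  using assms(1)
proof (induction T arbitrary: G rule: finite_induct)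
  case empty
  then show ?case by (simp add: fps_prod_nth_0)
next
  case (insert x T)
  let ?c = "\<lambda>T p i. card {t\<in>T. p t = i}"
  let ?h = "\<lambda>T G p. \<Prod>i\<in>I. fact (?c T p i) * fps_nth (G i) (?c T p i)"
  have step: "?h (insert x T) G (p(x := i0)) = ?h T (G(i0 := fps_deriv (G i0))) p" for p i0
  proof (rule prod.cong[OF refl])
    fix i
    have *: "{t \<in> insert x T. (p(x := i0)) t = i} =
        (if i = i0 then insert x {t\<in>T. p t = i} else {t\<in>T. p t = i})"
      using insert.hyps by auto
    show "fact (?c (insert x T) (p(x := i0)) i) * fps_nth (G i) (?c (insert x T) (p(x := i0)) i) =
        fact (?c T p i) * fps_nth ((G(i0 := fps_deriv (G i0))) i) (?c T p i)"
      unfolding * using insert.hyps by (simp add: algebra_simps)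
  qed
  have "(\<Sum>p\<in>insert x T \<rightarrow>\<^sub>E I. ?h (insert x T) G p) =
      (\<Sum>(i0, p)\<in>I \<times> (T \<rightarrow>\<^sub>E I). ?h (insert x T) G (p(x := i0)))"
    unfolding PiE_insert_eq using insert.hyps
    by (subst sum.reindex[OF inj_combinator[OF insert.hyps(2)]]) (simp only: o_def case_prod_unfold)
  also have "\<dots> = (\<Sum>i0\<in>I. \<Sum>p\<in>T \<rightarrow>\<^sub>E I. ?h T (G(i0 := fps_deriv (G i0))) p)"
    unfolding step by (simp only: sum.cartesian_product)
  also have "\<dots> = (\<Sum>i0\<in>I. fact (card T) * fps_nth (\<Prod>i\<in>I. (G(i0 := fps_deriv (G i0))) i) (card T))"
    by (intro sum.cong refl insert.IH)
  also have "\<dots> = fact (card T) * fps_nth (fps_deriv (\<Prod>i\<in>I. G i)) (card T)"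
    by (simp only: fps_deriv_prod[OF assms(2)] fps_sum_nth sum_distrib_left)
  also have "\<dots> = fact (card (insert x T)) * fps_nth (\<Prod>i\<in>I. G i) (card (insert x T))"
    using insert.hyps by (simp add: algebra_simps)
  finally show ?case .
qed

lemma count_list_map_sorted:
  assumes "finite T"
  shows "count_list (map p (sorted_list_of_set T)) i = card {t\<in>T. p t = i}"
proof -
  have "count_list (map p (sorted_list_of_set T)) i =
      length (filter (\<lambda>t. p t = i) (sorted_list_of_set T))"
    by (simp add: count_list_eq_length_filter filter_map o_def eq_commute)
  also have "\<dots> = card {t\<in>T. p t = i}"
    using assms by (subst distinct_length_filter) (auto intro: arg_cong[of _ _ card])
  finally show ?thesis .
qed

section \<open>Logarithmic series and their derivatives\<close>

lemma sum_ser_nth: "(\<Sum>x\<in>A. f x :: ser) w q = (\<Sum>x\<in>A. f x w q)"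
  by (induction A rule: infinite_finite_induct) auto

lemma smul_mon_log:
  assumes "\<And>w q. q \<noteq> 0 \<Longrightarrow> f w q = 0"
  shows "smul f (mon (\<lambda>_. 0) m) w q = (if q = m then f w 0 else 0)"
proof -
  have "q1 \<le> q \<and> f w1 q1 \<noteq> 0 \<and> mon (\<lambda>_. 0) m (w - w1) (q - q1) \<noteq> 0 \<longleftrightarrow>
      q = m \<and> f w 0 \<noteq> 0 \<and> w1 = w \<and> q1 = 0" for w1 q1
  proof -
    have "w - w1 = (\<lambda>_. 0) \<longleftrightarrow> w1 = w" by (auto simp: fun_eq_iff)
    then show ?thesis using assms[of q1 w1] by (cases "q1 = 0") (auto simp: mon_def)
  qed
  then have "{(w1, q1). q1 \<le> q \<and> f w1 q1 \<noteq> 0 \<and> mon (\<lambda>_. 0) m (w - w1) (q - q1) \<noteq> 0} =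
      (if q = m \<and> f w 0 \<noteq> 0 then {(w, 0)} else {})"
    by simp
  then show ?thesis
    by (auto simp: smul_def mon_def)
qed

lemma smul_mon:
  "smul (mon y p) g w q = (if p \<le> q then g (w - y) (q - p) else 0)"
proof -
  have "q1 \<le> q \<and> mon y p w1 q1 \<noteq> 0 \<and> g (w - w1) (q - q1) \<noteq> 0 \<longleftrightarrow>
      p \<le> q \<and> g (w - y) (q - p) \<noteq> 0 \<and> w1 = y \<and> q1 = p" for w1 q1
    by (auto simp: mon_def)
  then have "{(w1, q1). q1 \<le> q \<and> mon y p w1 q1 \<noteq> 0 \<and> g (w - w1) (q - q1) \<noteq> 0} =
      (if p \<le> q \<and> g (w - y) (q - p) \<noteq> 0 then {(y, p)} else {})"
    by simp
  then show ?thesis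
    by (auto simp: smul_def mon_def)
qed

lemma smul_mon_mon: "smul (mon y p) (mon y' p') = mon (y + y') (p + p')"
proof (intro ext)
  fix w q
  have "w - y = y' \<longleftrightarrow> w = y + y'" by (simp add: diff_eq_eq add.commute)
  then show "smul (mon y p) (mon y' p') w q = mon (y + y') (p + p') w q"
    unfolding smul_mon by (auto simp: mon_def)
qed

text \<open>
  This is $r!$ times the coefficient of $t^r$ in $\sum_w A_w(t)\, x^w \exp(t \log x_0)$, the form in
  which solutions of Frobenius type appear.
\<close>

definition logser :: "nat \<Rightarrow> ((nat \<Rightarrow> complex) \<Rightarrow> complex fps) \<Rightarrow> ser" where
  "logser r A = (\<lambda>w q. if q \<le> r then fact r / fact q * fps_nth (A w) (r - q) else 0)"

text \<open>
  Since $x_0^t = x^{t\ell}$, the derivative is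
  $\partial_j (x^w x_0^t) = (w_j + \ell_j t)\, x^{w - e_j} x_0^t$. The summand
  $\ell_j t$ comes from $\partial_j \log x_0$ and lowers the power of the logarithm by one.
\<close>

lemma pderiv_ser_logser:
  "pderiv_ser n k l j (logser r A) =
    logser r (\<lambda>w. lin (w j + 1) (of_int (ell n k l j)) * A (w(j := w j + 1)))"
proof (intro ext)
  fix w q
  consider "q > r" | "q = r" | "q < r" by linarith
  then show "pderiv_ser n k l j (logser r A) w q =
    logser r (\<lambda>w. lin (w j + 1) (of_int (ell n k l j)) * A (w(j := w j + 1))) w q"
  proof cases
    case 3
    define d where "d = r - Suc q"
    have d: "r - q = Suc d" "r - (q + 1) = d" "q \<le> r" "q + 1 \<le> r" using 3 by (auto simp: d_def)
    let ?a = "fps_nth (A (w(j := w j + 1)))" and ?e = "complex_of_int (ell n k l j)"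
    have fact_step: "of_nat (q + 1) * (fact r / fact (q + 1)) = (fact r / fact q :: complex)"
      by (simp del: of_nat_Suc)
    have "pderiv_ser n k l j (logser r A) w q =
        (w j + 1) * (fact r / fact q * ?a (Suc d)) + of_nat (q + 1) * (fact r / fact (q + 1)) * (?e * ?a d)"
      using d by (simp add: pderiv_ser_def logser_def mult_ac)
    also have "\<dots> = fact r / fact q * ((w j + 1) * ?a (Suc d) + ?e * ?a d)"
      unfolding fact_step by (simp only: algebra_simps)
    also have "\<dots> = logser r (\<lambda>w. lin (w j + 1) ?e * A (w(j := w j + 1))) w q"
      using d by (simp add: logser_def lin_def distrib_right mult.assoc)
    finally show ?thesis .
  qed (auto simp: pderiv_ser_def logser_def lin_def distrib_right mult.assoc)
qed

lemma pderiv_ser_power_logser: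
  "(pderiv_ser n k l j ^^ m) (logser r A) =
    logser r (\<lambda>w. (\<Prod>i = 1..m. lin (w j + of_nat i) (of_int (ell n k l j))) * A (w(j := w j + of_nat m)))"
proof (induction m)
  case 0
  then show ?case by simp
next
  case (Suc m)
  have "(\<Prod>i = 1..Suc m. lin (c + of_nat i) e) = lin (c + 1) e * (\<Prod>i = 1..m. lin (c + 1 + of_nat i) e)" for c e
    by (subst prod.atLeast_Suc_atMost) (simp_all add: prod.shift_bounds_cl_Suc_ivl add.assoc del: prod.cl_ivl_Suc)
  moreover have "(w(j := w j + 1))(j := (w(j := w j + 1)) j + of_nat m) = w(j := w j + of_nat (Suc m))"
    for w :: "nat \<Rightarrow> complex"
    by (simp add: algebra_simps)
  ultimately show ?case
    by (simp only: funpow.simps o_apply Suc pderiv_ser_logser fun_upd_same mult.assoc)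
qed

lemma dpower_logser:
  "dpower n k l \<alpha> (logser r A) =
    logser r (\<lambda>w. (\<Prod>j = 1..n. \<Prod>i = 1..\<alpha> j. lin (w j + of_nat i) (of_int (ell n k l j))) *
      A (\<lambda>j. if j \<in> {1..n} then w j + of_nat (\<alpha> j) else w j))"
proof -
  have "fold (\<lambda>j. pderiv_ser n k l j ^^ \<alpha> j) [1..<Suc N] (logser r A) =
    logser r (\<lambda>w. (\<Prod>j = 1..N. \<Prod>i = 1..\<alpha> j. lin (w j + of_nat i) (of_int (ell n k l j))) *
      A (\<lambda>j. if j \<in> {1..N} then w j + of_nat (\<alpha> j) else w j))" for N
  proof (induction N)
    case (Suc N)
    let ?w = "\<lambda>w::nat \<Rightarrow> complex. w(Suc N := w (Suc N) + of_nat (\<alpha> (Suc N)))"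
    have 1: "(\<lambda>j. if j \<in> {1..N} then ?w w j + of_nat (\<alpha> j) else ?w w j) =
        (\<lambda>j. if j \<in> {1..Suc N} then w j + of_nat (\<alpha> j) else w j)" for w
      by (rule ext) auto
    have 2: "(\<Prod>j = 1..N. \<Prod>i = 1..\<alpha> j. lin (?w w j + of_nat i) (of_int (ell n k l j))) =
        (\<Prod>j = 1..N. \<Prod>i = 1..\<alpha> j. lin (w j + of_nat i) (of_int (ell n k l j)))" for w
      by (intro prod.cong) auto
    have "fold (\<lambda>j. pderiv_ser n k l j ^^ \<alpha> j) [1..<Suc (Suc N)] (logser r A) =
        (pderiv_ser n k l (Suc N) ^^ \<alpha> (Suc N)) (fold (\<lambda>j. pderiv_ser n k l j ^^ \<alpha> j) [1..<Suc N] (logser r A))"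
      by (subst upt_Suc_append) auto
    then show ?case
      unfolding Suc pderiv_ser_power_logser 1 2 by (simp add: mult_ac)
  qed simp
  then show ?thesis by (simp only: dpower_def)
qed

lemma logser_cong:
  assumes "\<And>w s. s \<le> r \<Longrightarrow> fps_nth (A w) s = fps_nth (B w) s"
  shows "logser r A = logser r B"
  using assms by (auto simp: logser_def fun_eq_iff)

text \<open>
  In a vanishing linear combination choose $x$ with nonzero coefficient and maximal \<open>\<mu> x\<close>. Reading
  off the coefficient at \<open>(w x, q x)\<close> annihilates every other term.
\<close>

lemma triangular_family_independent:
  fixes f :: "'i \<Rightarrow> ser" and \<mu> :: "'i \<Rightarrow> nat"
  assumes "finite J"
    and diag: "\<And>x. x \<in> J \<Longrightarrow> f x (w x) (q x) \<noteq> 0"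
    and upper: "\<And>x y. x \<in> J \<Longrightarrow> y \<in> J \<Longrightarrow> f y (w x) (q x) \<noteq> 0 \<Longrightarrow> y = x \<or> \<mu> x < \<mu> y"
  shows "inj_on f J" "ser.independent (f ` J)"
proof -
  show inj: "inj_on f J"
  proof (rule inj_onI, rule ccontr)
    fix x y assume *: "x \<in> J" "y \<in> J" "f x = f y" "x \<noteq> y"
    then have "\<mu> x < \<mu> y" "\<mu> y < \<mu> x"
      using upper[of x y] upper[of y x] diag[of x] diag[of y] by auto
    then show False by simp
  qed
  show "ser.independent (f ` J)"
    unfolding ser.dependent_explicit
  proof clarify
    fix t c x0
    assume t: "finite t" "t \<subseteq> f ` J" "(\<Sum>g\<in>t. sscale (c g) g) = 0" and x0: "x0 \<in> t" "c x0 \<noteq> 0"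
    define X where "X = {x \<in> J. f x \<in> t \<and> c (f x) \<noteq> 0}"
    have "finite X" "X \<noteq> {}"
      using assms(1) t(2) x0 by (auto simp: X_def)
    then have "Max (\<mu> ` X) \<in> \<mu> ` X" by (intro Max_in) auto
    then obtain x where x: "x \<in> X" "\<mu> x = Max (\<mu> ` X)" by auto
    have x_max: "\<mu> y \<le> \<mu> x" if "y \<in> X" for y
      unfolding x(2) using \<open>finite X\<close> that by (intro Max_ge) auto
    have "0 = (\<Sum>g\<in>t. c g * g (w x) (q x))"
      using arg_cong[OF t(3), of "\<lambda>h. h (w x) (q x)"] by (simp add: sum_ser_nth sscale_def)
    also have "\<dots> = (\<Sum>g\<in>{f x}. c g * g (w x) (q x))"
    proof (rule sum.mono_neutral_right)
      show "\<forall>g\<in>t - {f x}. c g * g (w x) (q x) = 0"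
      proof (rule ballI, rule ccontr)
        fix g assume g: "g \<in> t - {f x}" "c g * g (w x) (q x) \<noteq> 0"
        then obtain y where y: "y \<in> J" "g = f y" using t(2) by auto
        then have "y \<in> X" "y \<noteq> x" using g by (auto simp: X_def)
        moreover have "y = x \<or> \<mu> x < \<mu> y"
          using upper[of x y] y g x(1) by (auto simp: X_def)
        ultimately show False using x_max[of y] by auto
      qed
    qed (use t x in \<open>auto simp: X_def\<close>)
    finally show False
      using diag[of x] x(1) by (auto simp: X_def)
  qed
qed

section \<open>The relation lattice and the exponents\<close>

(* Keeps the index range {1..n} from being rewritten to {Suc 0..n}. *)
declare One_nat_def [simp del]

lemma comb_nth: "comb n a w $ i = (\<Sum>j = 1..n. w j * of_int (a j $ i))"
  by (simp add: comb_def ovec_def)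

lemma comb_add: "comb n a (\<lambda>j. v j + w j) = comb n a v + comb n a w"
  by (simp add: vec_eq_iff comb_nth distrib_right sum.distrib)

lemma comb_scale: "comb n a (\<lambda>j. c * v j) = c *s comb n a v"
  by (simp add: vec_eq_iff comb_nth sum_distrib_left mult.assoc)

lemma comb_of_int: "comb n a (\<lambda>j. of_int (w j)) = ovec (comb n a w)"
  by (simp add: vec_eq_iff comb_nth ovec_def)

text \<open>
  In the language of matroids, a circuit is a minimal dependent set; the points of a \<open>codim_one\<close>
  configuration form one.
\<close>

locale circuit =
  fixes n k :: nat and a :: "nat \<Rightarrow> int ^ 'd" and l :: "nat \<Rightarrow> nat"
  assumes codim_one: "codim_one n k a l"
begin

abbreviation "ell' \<equiv> ell n k l"
abbreviation "cell j \<equiv> complex_of_int (ell n k l j)"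

lemma k_bounds: "1 \<le> k" "k \<le> n"
  using codim_one by (auto simp: codim_one_def)

lemma l_pos: "p \<in> {1..n} \<Longrightarrow> 0 < l p"
  using codim_one by (auto simp: codim_one_def)

lemma ell_first: "p \<in> {1..k} \<Longrightarrow> ell' p = int (l p)"
  using k_bounds by (auto simp: ell_def eps_def)

lemma ell_outside: "p \<notin> {1..n} \<Longrightarrow> ell' p = 0"
  by (auto simp: ell_def)

lemma ell_nonzero: "p \<in> {1..n} \<Longrightarrow> ell' p \<noteq> 0"
  using l_pos[of p] by (auto simp: ell_def eps_def)

lemma one_in: "1 \<in> {1..k}" "1 \<in> {1..n}"
  using k_bounds by auto

lemma comb_ell: "comb n a ell' = 0"
proof -
  have "ell' \<in> rel_lattice n k l"
    unfolding rel_lattice_def by (rule CollectI, rule exI[of _ 1]) simp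
  then show ?thesis
    using codim_one by (auto simp: codim_one_def fibre_def)
qed

lemma comb_cell: "comb n a cell = 0"
proof -
  have "comb n a cell = ovec (comb n a ell')"
    by (rule comb_of_int)
  then show ?thesis
    by (simp add: comb_ell ovec_def vec_eq_iff)
qed

lemma inj_a: "inj_on a {1..n}"
  using codim_one by (simp add: codim_one_def)

lemma inj_ovec: "inj_on (\<lambda>j. ovec (a j) :: ('b::ring_char_0) ^ 'd) {1..n}"
proof (rule inj_onI)
  fix i j assume "i \<in> {1..n}" "j \<in> {1..n}" and eq: "(ovec (a i) :: 'b ^ 'd) = ovec (a j)"
  from eq have "a i = a j" by (auto simp: ovec_def vec_eq_iff)
  then show "i = j"
    using inj_onD[OF inj_a] \<open>i \<in> _\<close> \<open>j \<in> _\<close> by blast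
qed

text \<open>
  The $n - 1$ points different from \<open>a i\<close> are independent.
\<close>

lemma real_relation_eq_0:
  fixes c :: "nat \<Rightarrow> real"
  assumes "comb n a c = 0" "i \<in> {1..n}" "c i = 0" "j \<in> {1..n}"
  shows "c j = 0"
proof (cases "j = i")
  case False
  let ?o = "\<lambda>j. ovec (a j) :: real ^ 'd"
  let ?I = "{1..n} - {i}" and ?B = "?o ` ({1..n} - {i})"
  have inj: "inj_on ?o ?I"
    by (rule inj_on_subset[OF inj_ovec]) auto
  have "independent ?B"
  proof -
    have "card ?B = n - 1"
      using assms(2) by (simp add: card_image[OF inj])
    moreover have "?B \<subseteq> ovec ` a ` {1..n}" by auto
    ultimately show ?thesis
      using codim_one by (auto simp: codim_one_def)
  qed
  moreover have "(\<Sum>x\<in>?B. c (the_inv_into ?I ?o x) *\<^sub>R x) = 0"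
  proof -
    have "(\<Sum>x\<in>?B. c (the_inv_into ?I ?o x) *\<^sub>R x) = (\<Sum>j\<in>?I. c j *\<^sub>R ?o j)"
      by (subst sum.reindex[OF inj]) (auto intro!: sum.cong simp: the_inv_into_f_f[OF inj])
    also have "\<dots> = (\<Sum>j = 1..n. c j *\<^sub>R ?o j)"
      using assms(2,3) by (intro sum.mono_neutral_left) auto
    finally show ?thesis
      using assms(1) by (simp add: comb_def scalar_mult_eq_scaleR)
  qed
  moreover have "?o j \<in> ?B" using assms(4) False by auto
  ultimately have "c (the_inv_into ?I ?o (?o j)) = 0"
    by (intro independentD[of ?B ?B "\<lambda>x. c (the_inv_into ?I ?o x)"]) auto
  then show ?thesis
    using assms(4) False by (simp add: the_inv_into_f_f[OF inj])
qed (use assms in simp)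

text \<open>
  The real and the imaginary part of $v - w$ are real relations with $i$-th coefficient $0$.
\<close>

lemma coords_eqI:
  fixes v w :: "nat \<Rightarrow> complex"
  assumes "v \<in> coords n" "w \<in> coords n" "comb n a v = comb n a w" "i \<in> {1..n}" "v i = w i"
  shows "v = w"
proof
  fix j
  define d where "d j = v j - w j" for j
  have "comb n a d $ m = 0" for m
    using assms(3) by (simp add: d_def comb_nth vec_eq_iff left_diff_distrib sum_subtractf)
  then have *: "(\<Sum>j = 1..n. d j * of_int (a j $ m)) = 0" for m
    by (simp add: comb_nth)
  have "comb n a (\<lambda>j. Re (d j)) = 0" "comb n a (\<lambda>j. Im (d j)) = 0"
    using arg_cong[OF *, of Re] arg_cong[OF *, of Im] by (simp_all add: vec_eq_iff comb_nth)
  then have "d j = 0" if "j \<in> {1..n}"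
    using real_relation_eq_0[of "\<lambda>j. Re (d j)" i j] real_relation_eq_0[of "\<lambda>j. Im (d j)" i j] that assms(4,5)
    by (simp add: d_def complex_eq_iff)
  then show "v j = w j"
    using assms(1,2) by (cases "j \<in> {1..n}") (auto simp: d_def coords_def)
qed

lemma coords_line: "v \<in> coords n \<Longrightarrow> (\<lambda>j. v j + c * cell j) \<in> coords n"
  by (auto simp: coords_def ell_outside)

lemma comb_line: "comb n a (\<lambda>j. v j + c * cell j) = comb n a v"
  by (simp add: comb_add comb_scale comb_cell)

text \<open>
  Moving any solution along $\ell$ adjusts its $i$-th coordinate, because $\ell_i \neq 0$.
\<close>

lemma exists_coords:
  fixes \<beta> :: "complex ^ 'd"
  assumes "\<beta> \<in> vec.span (ovec ` a ` {1..n})" "i \<in> {1..n}"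
  shows "\<exists>v\<in>coords n. comb n a v = \<beta> \<and> v i = c"
proof -
  let ?o = "\<lambda>j. ovec (a j) :: complex ^ 'd"
  from assms(1) obtain u where "\<beta> = (\<Sum>x\<in>?o ` {1..n}. u x *s x)"
    by (auto simp: vec.span_finite image_image)
  also have "\<dots> = (\<Sum>j = 1..n. u (?o j) *s ?o j)"
    by (subst sum.reindex[OF inj_ovec]) simp
  finally have \<beta>: "\<beta> = (\<Sum>j = 1..n. u (?o j) *s ?o j)" .
  define w where "w j = (if j \<in> {1..n} then u (?o j) else 0)" for j
  have w: "w \<in> coords n" "comb n a w = \<beta>"
    by (auto simp: coords_def w_def comb_def \<beta> intro: sum.cong)
  define t where "t = (c - w i) / cell i"
  have "w i + t * cell i = c"
    using ell_nonzero[OF assms(2)] by (simp add: t_def)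
  then show ?thesis
    using w by (intro bexI[of _ "\<lambda>j. w j + t * cell j"]) (auto simp: comb_line coords_line)
qed

lemma exponents_iff:
  assumes "\<beta> \<in> vec.span (ovec ` a ` {1..n})"
  shows "v \<in> exponents n k a l \<beta> \<longleftrightarrow>
    v \<in> coords n \<and> comb n a v = \<beta> \<and> (\<exists>i\<in>{1..k}. \<exists>b<l i. v i = of_nat b)"
proof -
  have *: "exponent n a \<beta> i b \<in> coords n \<and> exponent n a \<beta> i b i = of_nat b \<and> comb n a (exponent n a \<beta> i b) = \<beta>"
    if i: "i \<in> {1..n}" for i b
  proof -
    let ?P = "\<lambda>v. v \<in> coords n \<and> v i = of_nat b \<and> comb n a v = \<beta>"
    obtain v where "?P v" using exists_coords[OF assms i, of "of_nat b"] by auto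
    then have "\<exists>!v. ?P v"
      using coords_eqI[OF _ _ _ i] by (intro ex1I[of ?P v]) auto
    from theI'[OF this] show ?thesis by (simp add: exponent_def)
  qed
  have sub: "{1..k} \<subseteq> {1..n}" using k_bounds by auto
  show ?thesis
  proof
    assume "v \<in> exponents n k a l \<beta>"
    then obtain i b where "i \<in> {1..k}" "b < l i" "v = exponent n a \<beta> i b"
      by (auto simp: exponents_def)
    then show "v \<in> coords n \<and> comb n a v = \<beta> \<and> (\<exists>i\<in>{1..k}. \<exists>b<l i. v i = of_nat b)"
      using *[of i b] sub by auto
  next
    assume v: "v \<in> coords n \<and> comb n a v = \<beta> \<and> (\<exists>i\<in>{1..k}. \<exists>b<l i. v i = of_nat b)"
    then obtain i b where ib: "i \<in> {1..k}" "b < l i" "v i = of_nat b" by auto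
    then have "v = exponent n a \<beta> i b"
      using *[of i b] sub v by (intro coords_eqI[of _ _ i]) auto
    then show "v \<in> exponents n k a l \<beta>"
      using ib by (auto simp: exponents_def)
  qed
qed

lemma exponents'_iff:
  assumes "\<beta> \<in> vec.span (ovec ` a ` {1..n})"
  shows "v \<in> exponents' n k a l \<beta> \<longleftrightarrow>
    v \<in> coords n \<and> comb n a v = \<beta> \<and> (\<exists>i\<in>{1..k}. \<exists>b<l i. v i = of_nat b) \<and>
    (\<forall>i\<in>{1..k}. v i \<notin> neg_ints)"
  using exponents_iff[OF assms] by (auto simp: exponents'_def)

lemma comb_in_span: "comb n a w \<in> vec.span (ovec ` a ` {1..n})"
  unfolding comb_def by (intro vec.span_sum vec.span_scale vec.span_base) auto

lemma finite_exponents': "finite (exponents' n k a l \<beta>)"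
proof -
  have "exponents n k a l \<beta> = (\<lambda>(i, b). exponent n a \<beta> i b) ` (SIGMA i:{1..k}. {..<l i})"
    unfolding exponents_def by force
  then have "finite (exponents n k a l \<beta>)" by simp
  then show ?thesis by (rule finite_subset[rotated]) (auto simp: exponents'_def)
qed

text \<open>
  Far in the direction of $-\ell$ the $i$-th coordinate is a negative integer; far in the direction
  of $\ell$ none of the first $k$ coordinates is one. Somewhere in between, one step along $\ell$
  removes the last negative integers, and a coordinate $j$ that has just ceased to be negative lies
  in $\{0, \dots, \ell_j - 1\}$, which makes the vector an exponent.
\<close>

lemma exists_exponent'_in_coset:
  assumes w: "w \<in> coords n" and i: "i \<in> {1..k}" "w i \<in> \<int>"
  shows "\<exists>c::int. (\<lambda>j. w j + of_int c * cell j) \<in> exponents' n k a l (comb n a w)"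
proof -
  define C where "C = {c::int. \<forall>j\<in>{1..k}. w j + of_int (c * int (l j)) \<notin> neg_ints}"
  have sub: "j \<in> {1..n}" if "j \<in> {1..k}" for j using that k_bounds by auto
  have "eventually (\<lambda>c. \<forall>j\<in>{1..k}. w j + of_int (c * int (l j)) \<notin> neg_ints) at_top"
    using l_pos sub by (intro eventually_ball_finite ballI eventually_not_neg_ints) auto
  then obtain c1 where c1: "\<And>c. c \<ge> c1 \<Longrightarrow> c \<in> C"
    unfolding eventually_at_top_linorder C_def by blast
  obtain c0 where "w i + of_int (0 + c0 * int (l i)) \<in> neg_ints"
    using eventually_happens[OF eventually_neg_ints[OF i(2) l_pos[OF sub[OF i(1)]], of 0]] by auto
  then have c0: "c0 \<notin> C"
    using i(1) by (auto simp: C_def)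
  \<comment> \<open>The last step at which a negative integer disappears.\<close>
  have "\<exists>c. c - 1 \<notin> C \<and> c \<in> C"
  proof (rule ccontr)
    assume "\<nexists>c. c - 1 \<notin> C \<and> c \<in> C"
    then have step: "c + 1 \<notin> C" if "c \<notin> C" for c using that by (metis add_diff_cancel_right')
    have "c \<notin> C" if "c \<ge> c0" for c
      using that by (induction c rule: int_ge_induct) (use c0 step in auto)
    then show False using c1[of "max c0 c1"] by auto
  qed
  then obtain c where c: "c - 1 \<notin> C" "c \<in> C" by blast
  from c(1) obtain j where j: "j \<in> {1..k}" "w j + of_int ((c - 1) * int (l j)) \<in> neg_ints"
    by (auto simp: C_def)
  then obtain t where t: "t < 0" "w j + of_int ((c - 1) * int (l j)) = of_int t"
    unfolding neg_ints_def by blast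
  then have wj: "w j + of_int (c * int (l j)) = of_int (t + int (l j))"
    by (simp add: algebra_simps)
  have "w j + of_int (c * int (l j)) \<notin> neg_ints"
    using c(2) j(1) by (auto simp: C_def)
  then have "\<not> t + int (l j) < 0"
    unfolding wj of_int_neg_ints_iff .
  then have b: "nat (t + int (l j)) < l j" "of_int (t + int (l j)) = complex_of_nat (nat (t + int (l j)))"
    using t(1) by auto
  have *: "of_int c * cell p = of_int (c * int (l p))" if "p \<in> {1..k}" for p
    using that by (simp add: ell_first)
  have "w j + of_int c * cell j = of_nat (nat (t + int (l j)))"
    using wj b(2) by (simp only: *[OF j(1)])
  moreover have "\<forall>p\<in>{1..k}. w p + of_int c * cell p \<notin> neg_ints"
  proof
    fix p assume p: "p \<in> {1..k}"
    then have "w p + of_int (c * int (l p)) \<notin> neg_ints" using c(2) by (auto simp: C_def)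
    then show "w p + of_int c * cell p \<notin> neg_ints" unfolding *[OF p] .
  qed
  ultimately show ?thesis
    using b(1) j(1) w unfolding exponents'_iff[OF comb_in_span]
    by (intro exI[of _ c] conjI coords_line comb_line bexI[of _ j] exI[of _ "nat (t + int (l j))"]) auto
qed

text \<open>
  If $v' = v + c\ell$ with $c \ge 1$ and $i \le k$ is an index with $0 \le v'_i < \ell_i$, then
  $v_i = v'_i - c\ell_i$ is a negative integer, which $E'_\beta$ excludes. The case $c \le -1$ is
  symmetric.
\<close>

lemma exponents'_coset_unique:
  assumes \<beta>: "\<beta> \<in> vec.span (ovec ` a ` {1..n})"
    and v: "v \<in> exponents' n k a l \<beta>" "v' \<in> exponents' n k a l \<beta>"
    and c: "\<And>j. v' j = v j + of_int c * cell j"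
  shows "v' = v"
proof -
  have no_pos: False
    if vv: "v \<in> exponents' n k a l \<beta>" "v' \<in> exponents' n k a l \<beta>"
      "\<And>j. v' j = v j + of_int c * cell j" "c \<ge> 1" for v v' and c :: int
  proof -
    obtain i b where ib: "i \<in> {1..k}" "b < l i" "v' i = of_nat b"
      using vv(2) unfolding exponents'_iff[OF \<beta>] by blast
    have "v i = of_int (int b - c * int (l i))"
      using vv(3)[of i] ib by (simp add: ell_first)
    moreover have "int b - c * int (l i) < 0"
    proof -
      have "1 * int (l i) \<le> c * int (l i)" using vv(4) by (intro mult_right_mono) auto
      then show ?thesis using ib(2) by linarith
    qed
    ultimately have "v i \<in> neg_ints" by (simp only: of_int_neg_ints_iff)
    then show False using vv(1) ib(1) unfolding exponents'_iff[OF \<beta>] by blast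
  qed
  have "\<not> c \<ge> 1" using no_pos[OF v c] by blast
  moreover have "\<not> - c \<ge> 1" using no_pos[OF v(2,1), of "- c"] c by auto
  ultimately have "c = 0" by simp
  then show ?thesis using c by auto
qed

text \<open>
  Reduction of $v_i$ modulo $\ell_i$ sends the pairs $(v, i)$, $i \in M_v$, to the pairs $(i, b)$ with
  $b < \ell_i$. The vectors of weight $\beta$ whose $i$-th coordinate is an integer congruent to $b$
  form one coset of $\mathbb{Z}\ell$, and this coset contains exactly one element of $E'_\beta$.
\<close>

lemma sum_log_mult:
  assumes \<beta>: "\<beta> \<in> vec.span (ovec ` a ` {1..n})"
  shows "(\<Sum>v\<in>exponents' n k a l \<beta>. log_mult k v) = (\<Sum>i = 1..k. l i)"
proof -
  let ?E = "exponents' n k a l \<beta>"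
  let ?A = "SIGMA v:?E. {i \<in> {1..k}. v i \<in> \<nat>}" and ?B = "SIGMA i:{1..k}. {..<l i}"
  let ?val = "\<lambda>c::complex. nat \<lfloor>Re c\<rfloor>"
  let ?h = "\<lambda>(v, i). (i, ?val (v i) mod l i)"
  have sub: "i \<in> {1..n}" if "i \<in> {1..k}" for i using that k_bounds by auto
  have val: "c = of_nat (?val c)" if "c \<in> \<nat>" for c
    using that by (auto elim: Nats_cases)
  have E: "v \<in> coords n" "comb n a v = \<beta>" if "v \<in> ?E" for v
    using that unfolding exponents'_iff[OF \<beta>] by auto
  have "bij_betw ?h ?A ?B"
    unfolding bij_betw_def
  proof
    show "inj_on ?h ?A"
    proof (rule inj_onI)
      fix x y assume xy: "x \<in> ?A" "y \<in> ?A" "?h x = ?h y"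
      obtain v i v' where x: "x = (v, i)" and y: "y = (v', i)"
        using xy(3) by (cases x, cases y) auto
      have v: "v \<in> ?E" "v i \<in> \<nat>" "v' \<in> ?E" "v' i \<in> \<nat>"
        and eq: "?val (v i) mod l i = ?val (v' i) mod l i"
        using xy by (auto simp: x y)
      have i: "i \<in> {1..k}" "i \<in> {1..n}" using xy(1) sub by (auto simp: x)
      have "int (?val (v i)) mod int (l i) = int (?val (v' i)) mod int (l i)"
        using eq by (simp only: flip: zmod_int)
      then obtain c where c: "int (?val (v' i)) = int (?val (v i)) + int (l i) * c"
        by (rule mod_eqE)
      have "v' i = of_int (int (?val (v' i)))" "v i = of_int (int (?val (v i)))"
        unfolding of_int_of_nat_eq using val[OF v(4)] val[OF v(2)] .
      then have vi: "v' i = v i + of_int c * cell i"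
        using c by (simp only: ell_first[OF i(1)] of_int_add of_int_mult mult.commute)
      have "v' = (\<lambda>j. v j + of_int c * cell j)"
        using E[OF v(1)] E[OF v(3)] vi by (intro coords_eqI[OF _ _ _ i(2)] coords_line) (auto simp: comb_line)
      then have "v' = v"
        by (intro exponents'_coset_unique[OF \<beta> v(1,3), of c]) (rule fun_cong)
      then show "x = y" by (simp add: x y)
    qed
    show "?h ` ?A = ?B"
    proof
      show "?h ` ?A \<subseteq> ?B" using l_pos sub by auto
      show "?B \<subseteq> ?h ` ?A"
      proof
        fix y assume "y \<in> ?B"
        then obtain i b where y: "y = (i, b)" and i: "i \<in> {1..k}" and b: "b \<in> {..<l i}"
          by blast
        obtain w where w: "w \<in> coords n" "comb n a w = \<beta>" "w i = of_nat b"
          using exists_coords[OF \<beta> sub[OF i]] by blast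
        obtain c where c: "(\<lambda>j. w j + of_int c * cell j) \<in> ?E"
          using exists_exponent'_in_coset[OF w(1) i] w(2,3) by auto
        define v where "v = (\<lambda>j. w j + of_int c * cell j)"
        have vi: "v i = of_int (int b + c * int (l i))"
          using w(3) by (simp add: v_def ell_first[OF i])
        moreover have "v i \<notin> neg_ints"
          using c i unfolding exponents'_iff[OF \<beta>] v_def[symmetric] by blast
        ultimately have "\<not> int b + c * int (l i) < 0"
          by (simp only: of_int_neg_ints_iff not_False_eq_True)
        then have "int (nat (int b + c * int (l i))) = int b + c * int (l i)" by simp
        then have vn: "v i = of_nat (nat (int b + c * int (l i)))"
          unfolding vi by (metis of_int_of_nat_eq)
        have "int (nat (int b + c * int (l i)) mod l i) = (int b + c * int (l i)) mod int (l i)"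
          using \<open>int (nat _) = _\<close> by (simp add: zmod_int)
        also have "\<dots> = int b" using b by simp
        finally have "nat (int b + c * int (l i)) mod l i = b" by (simp only: of_nat_eq_iff)
        then have "?val (v i) mod l i = b" unfolding vn by (simp only: complex_Re_of_nat floor_of_nat nat_int)
        then show "y \<in> ?h ` ?A"
          unfolding y using c i vn by (intro image_eqI[of _ _ "(v, i)"]) (auto simp: v_def[symmetric])
      qed
    qed
  qed
  then have "card ?A = card ?B" by (rule bij_betw_same_card)
  then show ?thesis
    using finite_exponents'[of \<beta>] by (simp add: log_mult_def)
qed

lemma log_mult_pos:
  assumes "v \<in> exponents' n k a l \<beta>" "\<beta> \<in> vec.span (ovec ` a ` {1..n})"
  shows "\<exists>i\<in>{1..k}. v i \<in> \<nat>" "log_mult k v > 0"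
proof -
  show *: "\<exists>i\<in>{1..k}. v i \<in> \<nat>"
    using assms(1) unfolding exponents'_iff[OF assms(2)] by (metis of_nat_in_Nats)
  then show "log_mult k v > 0"
    by (auto simp: log_mult_def card_gt_0_iff)
qed

section \<open>The Frobenius series\<close>

definition frob_coeff :: "(nat \<Rightarrow> int) \<Rightarrow> (nat \<Rightarrow> complex) \<Rightarrow> int \<Rightarrow> complex fps" where
  "frob_coeff lu v z = (\<Prod>j = 1..n. gamma_ratio (lu j + z * ell' j) (v j) (cell j))"

text \<open>
  The coefficients of the Frobenius series, extended by $0$ to all exponent vectors $w$. The sum has
  at most one term.
\<close>

definition frob_series :: "(nat \<Rightarrow> int) \<Rightarrow> (nat \<Rightarrow> complex) \<Rightarrow> (nat \<Rightarrow> complex) \<Rightarrow> complex fps" where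
  "frob_series lu v w = (\<Sum>z | w = shift n k l lu v z. frob_coeff lu v z)"

lemma shift_inj: "shift n k l lu v z = shift n k l lu v z' \<longleftrightarrow> z = z'"
proof
  assume "shift n k l lu v z = shift n k l lu v z'"
  from fun_cong[OF this, of 1] have "cell 1 * (of_int z - of_int z') = 0"
    by (simp add: shift_def algebra_simps)
  then show "z = z'" using ell_nonzero[OF one_in(2)] by simp
qed simp

lemma shift_solutions: "{z. shift n k l lu v z0 = shift n k l lu v z} = {z0}"
  by (auto simp: shift_inj)

lemma frob_series_shift: "frob_series lu v (shift n k l lu v z) = frob_coeff lu v z"
  by (simp add: frob_series_def shift_solutions)

lemma frob_series_eq_0: "w \<notin> range (shift n k l lu v) \<Longrightarrow> frob_series lu v w = 0"
  by (auto simp: frob_series_def intro!: sum.neutral)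

lemma finite_shift_solutions: "finite {z. w = shift n k l lu v z}"
  by (rule finite_subset[of _ "if w \<in> range (shift n k l lu v) then {SOME z. w = shift n k l lu v z} else {}"])
    (auto simp: shift_inj)

lemma Phi_coeff_eq:
  "Phi_coeff n k l lu v Q z = (\<Prod>j = 1..n. Mconst (lu j + z * ell' j) (count_list Q j) (v j))"
proof -
  have "{1..n} = {1..k} \<union> {k + 1..n}" "{1..k} \<inter> {k + 1..n} = {}" using k_bounds by auto
  then have "(\<Prod>j = 1..n. Mconst (lu j + z * ell' j) (count_list Q j) (v j)) =
     (\<Prod>j = 1..k. Mconst (lu j + z * ell' j) (count_list Q j) (v j)) *
     (\<Prod>j = k + 1..n. Mconst (lu j + z * ell' j) (count_list Q j) (v j))"
    by (simp add: prod.union_disjoint)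
  also have "\<dots> = Phi_coeff n k l lu v Q z"
    unfolding Phi_coeff_def using k_bounds
    by (intro arg_cong2[of _ _ _ _ "(*)"] prod.cong refl) (auto simp: ell_def eps_def)
  finally show ?thesis ..
qed

text \<open>
  If $z$ is outside the index set of the series, the coordinate of some $j$ that does not occur in
  $Q$ enters or leaves the negative integers. On entering, the constant term at $t = 0$ is zero;
  on leaving, the division by zero in \<open>Mconst\<close> gives $0$.
\<close>

lemma Phi_coeff_eq_0:
  assumes "z \<notin> zset n k l lu v ({1..n} - set Q)"
  shows "Phi_coeff n k l lu v Q z = 0"
proof -
  let ?m = "\<lambda>j. lu j + z * ell' j"
  from assms obtain j where j: "j \<in> {1..n}" "j \<notin> set Q" "(v j \<in> neg_ints) \<noteq> (v j + of_int (?m j) \<in> neg_ints)"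
    by (auto simp: zset_def nsupp_def shift_def)
  then have "Mconst (?m j) (count_list Q j) (v j) = 0"
    using gamma_ratio_nth[of "?m j" "v j" 1 0] gamma_ratio_nth_0_iff[of "?m j" "v j" 1]
    by (simp add: count_list_0_iff)
  then show ?thesis
    unfolding Phi_coeff_eq using j(1) by (auto intro!: prod_zero)
qed

lemma Phi_eq:
  "Phi n k l lu v Q w q = (if q = 0
     then \<Sum>z | w = shift n k l lu v z. \<Prod>j = 1..n. fact (count_list Q j) * Mconst (lu j + z * ell' j) (count_list Q j) (v j)
     else 0)"
proof -
  have "(\<Sum>z | z \<in> zset n k l lu v ({1..n} - set Q) \<and> w = shift n k l lu v z. Phi_coeff n k l lu v Q z) =
      (\<Sum>z | w = shift n k l lu v z. Phi_coeff n k l lu v Q z)"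
    using finite_shift_solutions[of w lu v]
    by (intro sum.mono_neutral_left) (auto intro: Phi_coeff_eq_0)
  then show ?thesis
    by (simp add: Phi_def sum_distrib_left prod.distrib Phi_coeff_eq)
qed

text \<open>
  The words on the positions in $T$ contribute $s!$ times the coefficient of $t^s$, where
  $s = |T|$, and the ${r \choose s}$ choices of $T$ turn this into $r! / (r - s)!$, as required next
  to $\log^{r-s} x_0$.
\<close>

lemma S_series_eq_logser: "S_series n k l lu v r = logser r (frob_series lu v)"
proof (intro ext)
  fix w q
  let ?F = "\<lambda>z. \<lambda>j. gamma_ratio (lu j + z * ell' j) (v j) (cell j)"
  let ?Z = "{z. w = shift n k l lu v z}"
  let ?c = "\<lambda>T p j. card {t\<in>T. p t = j}"
  have word_sum: "(\<Sum>p \<in> T \<rightarrow>\<^sub>E {1..n}. (\<Prod>t\<in>T. of_int (eps k (p t)) * of_nat (l (p t))) *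
      Phi n k l lu v (map p (sorted_list_of_set T)) w 0) = fact (card T) * fps_nth (frob_series lu v w) (card T)"
    if "finite T" for T
  proof -
    have "(\<Sum>p \<in> T \<rightarrow>\<^sub>E {1..n}. (\<Prod>t\<in>T. of_int (eps k (p t)) * of_nat (l (p t))) *
        Phi n k l lu v (map p (sorted_list_of_set T)) w 0) =
        (\<Sum>p \<in> T \<rightarrow>\<^sub>E {1..n}. \<Sum>z\<in>?Z. \<Prod>j = 1..n. fact (?c T p j) * fps_nth (?F z j) (?c T p j))"
    proof (rule sum.cong[OF refl])
      fix p assume p: "p \<in> T \<rightarrow>\<^sub>E {1..n}"
      \<comment> \<open>Each of the \<open>?c T p j\<close> occurrences of the letter \<open>j\<close> supplies a factor \<open>cell j\<close>.\<close>
      have "(\<Prod>t\<in>T. of_int (eps k (p t)) * of_nat (l (p t))) = (\<Prod>t\<in>T. cell (p t))"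
        using p by (intro prod.cong) (auto simp: ell_def PiE_iff)
      also have "\<dots> = (\<Prod>j = 1..n. \<Prod>t | t \<in> T \<and> p t = j. cell (p t))"
        using p by (intro prod.group[symmetric] that) (auto simp: PiE_iff)
      also have "\<dots> = (\<Prod>j = 1..n. cell j ^ ?c T p j)"
        by (intro prod.cong) auto
      finally show "(\<Prod>t\<in>T. of_int (eps k (p t)) * of_nat (l (p t))) *
          Phi n k l lu v (map p (sorted_list_of_set T)) w 0 =
          (\<Sum>z\<in>?Z. \<Prod>j = 1..n. fact (?c T p j) * fps_nth (?F z j) (?c T p j))"
        by (simp add: Phi_eq count_list_map_sorted[OF that] gamma_ratio_nth sum_distrib_left prod.distrib mult_ac)
    qed
    also have "\<dots> = (\<Sum>z\<in>?Z. fact (card T) * fps_nth (frob_coeff lu v z) (card T))"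
      by (subst sum.swap) (simp add: sum_words_fact_prod[OF that] frob_coeff_def)
    finally show ?thesis
      by (simp add: frob_series_def fps_sum_nth sum_distrib_left)
  qed
  have "S_series n k l lu v r w q =
      (\<Sum>s = 0..r. \<Sum>T | T \<subseteq> {1..r} \<and> card T = s. \<Sum>p \<in> T \<rightarrow>\<^sub>E {1..n}.
        (\<Prod>t\<in>T. of_int (eps k (p t)) * of_nat (l (p t))) *
          (if q = r - s then Phi n k l lu v (map p (sorted_list_of_set T)) w 0 else 0))"
    unfolding S_series_def by (simp add: sum_ser_nth sscale_def smul_mon_log Phi_eq)
  also have "\<dots> = (\<Sum>s = 0..r. if q = r - s
      then \<Sum>T | T \<subseteq> {1..r} \<and> card T = s. fact s * fps_nth (frob_series lu v w) s else 0)"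
  proof (rule sum.cong[OF refl], goal_cases)
    case (1 s)
    show ?case
    proof (cases "q = r - s")
      case True
      have "(\<Sum>p \<in> T \<rightarrow>\<^sub>E {1..n}. (\<Prod>t\<in>T. of_int (eps k (p t)) * of_nat (l (p t))) *
          Phi n k l lu v (map p (sorted_list_of_set T)) w 0) = fact s * fps_nth (frob_series lu v w) s"
        if "T \<subseteq> {1..r} \<and> card T = s" for T
        using word_sum[of T] that finite_subset[of T "{1..r}"] by auto
      then show ?thesis using True by (simp only: simp_thms if_True) (rule sum.cong, auto)
    qed simp
  qed
  also have "\<dots> = (\<Sum>s = 0..r. if q = r - s then of_nat (r choose s) * (fact s * fps_nth (frob_series lu v w) s) else 0)"
    using n_subsets[of "{1..r}"] by (intro sum.cong) auto
  also have "\<dots> = (\<Sum>s = 0..r. if s = r - q \<and> q \<le> r then of_nat (r choose s) * (fact s * fps_nth (frob_series lu v w) s) else 0)"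
    by (intro sum.cong) auto
  also have "\<dots> = (if q \<le> r then of_nat (r choose (r - q)) * (fact (r - q) * fps_nth (frob_series lu v w) (r - q)) else 0)"
    by (cases "q \<le> r") (simp_all add: sum.delta)
  also have "\<dots> = logser r (frob_series lu v) w q"
    by (simp add: logser_def binomial_fact)
  finally show "S_series n k l lu v r w q = logser r (frob_series lu v) w q" .
qed

text \<open>
  For $z \to -\infty$ every index $i \in M_v$ contributes a factor that vanishes at $t = 0$.
\<close>

lemma frob_coeff_bounded_below:
  "\<exists>N. \<forall>z s. s < log_mult k v \<longrightarrow> fps_nth (frob_coeff lu v z) s \<noteq> 0 \<longrightarrow> z \<ge> N"
proof -
  let ?M = "{i \<in> {1..k}. v i \<in> \<nat>}"
  have sub: "?M \<subseteq> {1..n}" using k_bounds by auto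
  have "eventually (\<lambda>z. \<forall>i\<in>?M. v i + of_int (lu i + z * ell' i) \<in> neg_ints) at_bot"
  proof (intro eventually_ball_finite ballI)
    fix i assume i: "i \<in> ?M"
    then have "v i \<in> \<int>" "0 < l i"
      using Nats_subset_Ints l_pos[of i] sub by blast+
    from eventually_neg_ints[OF this, of "lu i"]
    show "eventually (\<lambda>z. v i + of_int (lu i + z * ell' i) \<in> neg_ints) at_bot"
      using i by (simp add: ell_first)
  qed simp
  then obtain N where N: "\<And>z i. z \<le> N \<Longrightarrow> i \<in> ?M \<Longrightarrow> v i + of_int (lu i + z * ell' i) \<in> neg_ints"
    unfolding eventually_at_bot_linorder by blast
  have "fps_nth (frob_coeff lu v z) s = 0" if "z \<le> N" "s < log_mult k v" for z s
  proof -
    let ?F = "\<lambda>j. gamma_ratio (lu j + z * ell' j) (v j) (cell j)"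
    have "fps_nth (?F i) 0 = 0" if "i \<in> ?M" for i
      using N[OF \<open>z \<le> N\<close> that] that Nats_not_neg_ints[of "v i"] unfolding gamma_ratio_nth_0_iff by auto
    then have "fps_nth (\<Prod>i\<in>?M. ?F i) t = 0" if "t \<le> s" for t
      using that \<open>s < _\<close> by (intro fps_prod_nth_eq_0) (auto simp: log_mult_def)
    then have "fps_nth ((\<Prod>i\<in>?M. ?F i) * (\<Prod>j\<in>{1..n} - ?M. ?F j)) s = 0"
      by (rule fps_mult_nth_eq_0)
    also have "(\<Prod>i\<in>?M. ?F i) * (\<Prod>j\<in>{1..n} - ?M. ?F j) = frob_coeff lu v z"
      unfolding frob_coeff_def using sub by (subst prod.subset_diff[OF sub]) (auto simp: mult.commute)
    finally show ?thesis .
  qed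
  then show ?thesis by (intro exI[of _ N]) (meson linear)
qed

section \<open>The differential equations\<close>

text \<open>
  The logarithm contributes the multiple $\sum_j \ell_j \mathbf{a}_j = 0$, so an Euler operator only
  sees the weight of the exponents.
\<close>

lemma euler_op_eq_0:
  assumes "\<And>w q. f w q \<noteq> 0 \<Longrightarrow> comb n a w = \<gamma>"
  shows "euler_op n k a l \<gamma> i f = 0"
proof (intro ext)
  fix w q
  have *: "times_var j (pderiv_ser n k l j f) w q =
      w j * f w q + of_nat (q + 1) * cell j * f w (q + 1)" for j
    by (simp add: times_var_def pderiv_ser_def)
  have "(\<Sum>j = 1..n. of_int (a j $ i) * (w j * f w q + of_nat (q + 1) * cell j * f w (q + 1))) =
      (comb n a w $ i) * f w q + of_nat (q + 1) * f w (q + 1) * (comb n a cell $ i)"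
    by (simp add: comb_nth algebra_simps sum.distrib sum_distrib_left)
  then have "euler_op n k a l \<gamma> i f w q = (comb n a w $ i) * f w q - \<gamma> $ i * f w q"
    by (simp add: euler_op_def sum_ser_nth sscale_def * comb_cell)
  then show "euler_op n k a l \<gamma> i f w q = 0 w q"
    using assms[of w q] by auto
qed

text \<open>
  The indices whose factor vanishes at $t = 0$ without vanishing identically.
\<close>

definition zeros :: "(nat \<Rightarrow> int) \<Rightarrow> (nat \<Rightarrow> complex) \<Rightarrow> int \<Rightarrow> nat set" where
  "zeros lu v z = {j \<in> {1..n}. v j \<notin> neg_ints \<and> v j + of_int (lu j + z * ell' j) \<in> neg_ints}"

lemma shift_in_fibre:
  assumes "lu \<in> fibre n a u"
  shows "(\<lambda>j. lu j + z * ell' j) \<in> fibre n a u"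
  using assms by (auto simp: fibre_def comb_add comb_scale comb_ell coords_def ell_outside)

text \<open>
  Suppose there are fewer than $m$ zeros and let $I$ consist of the other indices. Then $I$ is large
  enough for the minimality condition. On $I$ no coordinate becomes a negative integer, while the
  coordinate responsible for the pole ceases to be one, so the negative support shrinks.
\<close>

lemma many_zeros_at_pole:
  assumes lu: "lu \<in> fibre n a u"
    and min: "\<And>I. I \<subseteq> {1..n} \<Longrightarrow> card I \<ge> n - (m - 1) \<Longrightarrow> min_nsupp n a I u v"
    and pole: "frob_coeff lu v z = 0"
  shows "m \<le> card (zeros lu v z)"
proof (rule ccontr)
  assume "\<not> m \<le> card (zeros lu v z)"
  let ?I = "{1..n} - zeros lu v z" and ?y = "\<lambda>j. lu j + z * ell' j"
  have "zeros lu v z \<subseteq> {1..n}" by (auto simp: zeros_def)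
  then have "card ?I \<ge> n - (m - 1)"
    using \<open>\<not> m \<le> _\<close> by (simp add: card_Diff_subset finite_subset)
  then have "min_nsupp n a ?I u v" by (intro min) auto
  then have "\<not> nsupp ?I (\<lambda>j. v j + of_int (?y j)) \<subset> nsupp ?I v"
    unfolding min_nsupp_def by (rule bspec[OF _ shift_in_fibre[OF lu]])
  moreover obtain j where j: "j \<in> {1..n}" "gamma_ratio (?y j) (v j) (cell j) = 0"
    using pole by (auto simp: frob_coeff_def)
  then have "v j \<in> neg_ints" "v j + of_int (?y j) \<notin> neg_ints"
    using gamma_ratio_eq_0_iff[of "cell j"] ell_nonzero[of j] by auto
  then have "j \<in> nsupp ?I v - nsupp ?I (\<lambda>j. v j + of_int (?y j))"
    using j by (auto simp: nsupp_def zeros_def)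
  moreover have "nsupp ?I (\<lambda>j. v j + of_int (?y j)) \<subseteq> nsupp ?I v"
    by (auto simp: nsupp_def zeros_def)
  ultimately show False by blast
qed

text \<open>
  The factor by which $\partial^\alpha$ multiplies a coefficient on its way to the exponent $w$.
\<close>

definition lowering :: "(nat \<Rightarrow> nat) \<Rightarrow> (nat \<Rightarrow> complex) \<Rightarrow> complex fps" where
  "lowering \<alpha> w = (\<Prod>j = 1..n. \<Prod>i = 1..\<alpha> j. lin (w j + of_nat i) (cell j))"

lemma lowering_mult_frob_coeff:
  assumes "frob_coeff lu v z \<noteq> 0"
    and w: "\<And>j. j \<in> {1..n} \<Longrightarrow> w j + of_nat (\<alpha> j) = shift n k l lu v z j"
  shows "lowering \<alpha> w * frob_coeff lu v z = (\<Prod>j = 1..n. gamma_ratio (lu j + z * ell' j - int (\<alpha> j)) (v j) (cell j))"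
  unfolding lowering_def frob_coeff_def prod.distrib[symmetric]
proof (rule prod.cong[OF refl])
  fix j assume j: "j \<in> {1..n}"
  have "gamma_ratio (lu j + z * ell' j) (v j) (cell j) \<noteq> 0"
    using assms(1) j by (auto simp: frob_coeff_def)
  moreover have "w j = v j + of_int (lu j + z * ell' j) - of_nat (\<alpha> j)"
    using w[OF j] by (simp add: shift_def eq_diff_eq)
  ultimately show "(\<Prod>i = 1..\<alpha> j. lin (w j + of_nat i) (cell j)) * gamma_ratio (lu j + z * ell' j) (v j) (cell j) =
      gamma_ratio (lu j + z * ell' j - int (\<alpha> j)) (v j) (cell j)"
    using ell_nonzero[OF j] by (simp only: prod_lin_mult_gamma_ratio of_int_eq_0_iff not_False_eq_True)
qed

text \<open>
  Both sides are carried to the same exponent, so they agree by the functional equation unless $z'$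
  is a pole. In that case the right-hand side is $0$. The indices in \<open>zeros lu v z'\<close> are
  still zeros after the further lowering, which makes the left-hand side divisible by $t^m$.
\<close>

lemma lowering_agree:
  assumes lu: "lu \<in> fibre n a u"
    and min: "\<And>I. I \<subseteq> {1..n} \<Longrightarrow> card I \<ge> n - (m - 1) \<Longrightarrow> min_nsupp n a I u v"
    and w: "\<And>j. j \<in> {1..n} \<Longrightarrow> w j + of_nat (\<alpha> j) = shift n k l lu v z j"
      "\<And>j. j \<in> {1..n} \<Longrightarrow> w j + of_nat (\<alpha>' j) = shift n k l lu v z' j"
    and "frob_coeff lu v z \<noteq> 0" "s < m"
  shows "fps_nth (lowering \<alpha> w * frob_coeff lu v z) s = fps_nth (lowering \<alpha>' w * frob_coeff lu v z') s"
proof -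
  let ?F = "\<lambda>j. gamma_ratio (lu j + z * ell' j - int (\<alpha> j)) (v j) (cell j)"
  have F: "lowering \<alpha> w * frob_coeff lu v z = (\<Prod>j = 1..n. ?F j)"
    using assms by (intro lowering_mult_frob_coeff) auto
  have same: "lu j + z * ell' j - int (\<alpha> j) = lu j + z' * ell' j - int (\<alpha>' j)" if "j \<in> {1..n}" for j
  proof -
    have "complex_of_int (lu j + z * ell' j - int (\<alpha> j)) = of_int (lu j + z' * ell' j - int (\<alpha>' j))"
      using w(1)[OF that] w(2)[OF that] by (simp add: shift_def algebra_simps) algebra
    then show ?thesis by (simp only: of_int_eq_iff)
  qed
  show ?thesis
  proof (cases "frob_coeff lu v z' = 0")
    case False
    have "lowering \<alpha>' w * frob_coeff lu v z' =
        (\<Prod>j = 1..n. gamma_ratio (lu j + z' * ell' j - int (\<alpha>' j)) (v j) (cell j))"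
      using False w(2) by (intro lowering_mult_frob_coeff) auto
    also have "\<dots> = (\<Prod>j = 1..n. ?F j)"
      by (intro prod.cong refl) (simp only: same)
    finally show ?thesis using F by simp
  next
    case True
    let ?Z = "zeros lu v z'"
    have Z: "?Z \<subseteq> {1..n}" "finite ?Z" by (auto simp: zeros_def)
    have "fps_nth (?F j) 0 = 0" if "j \<in> ?Z" for j
    proof -
      have j: "j \<in> {1..n}" using that Z by auto
      have zero: "v j \<notin> neg_ints" "v j + of_int (lu j + z' * ell' j) \<in> neg_ints"
        using that unfolding zeros_def by blast+
      have "v j + of_int (lu j + z' * ell' j) + of_int (- int (\<alpha>' j)) \<in> neg_ints"
        by (rule neg_ints_crossing(4)[OF _ zero(2)]) simp
      also have "v j + of_int (lu j + z' * ell' j) + of_int (- int (\<alpha>' j)) =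
          v j + of_int (lu j + z' * ell' j - int (\<alpha>' j))"
        by simp
      finally show ?thesis
        using zero(1) by (simp only: gamma_ratio_nth_0_iff same[OF j] simp_thms)
    qed
    moreover have "m \<le> card ?Z"
      by (rule many_zeros_at_pole[OF lu min True])
    ultimately have "fps_nth (\<Prod>j\<in>?Z. ?F j) i = 0" if "i \<le> s" for i
      using fps_prod_nth_eq_0[OF Z(2), of ?F i] that \<open>s < m\<close> by auto
    then have "fps_nth ((\<Prod>j\<in>?Z. ?F j) * (\<Prod>j\<in>{1..n} - ?Z. ?F j)) s = 0"
      by (rule fps_mult_nth_eq_0)
    also have "(\<Prod>j\<in>?Z. ?F j) * (\<Prod>j\<in>{1..n} - ?Z. ?F j) = (\<Prod>j = 1..n. ?F j)"
      using Z by (subst prod.subset_diff[of ?Z]) (auto simp: mult.commute)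
    finally show ?thesis using F True by simp
  qed
qed

text \<open>
  For the relation $b\ell$, the positive half of the operator carries the term $z$ to the exponent to
  which the negative half carries the term $z - b$.
\<close>

lemma box_op_eq_0:
  assumes lu: "lu \<in> fibre n a u"
    and min: "\<And>I. I \<subseteq> {1..n} \<Longrightarrow> card I \<ge> n - (m - 1) \<Longrightarrow> min_nsupp n a I u v"
    and "r < m" "y \<in> rel_lattice n k l"
  shows "box_op n k l y (logser r (frob_series lu v)) = 0"
proof -
  obtain b where y: "y = (\<lambda>p. b * ell' p)"
    using assms(4) by (auto simp: rel_lattice_def)
  let ?\<alpha> = "\<lambda>j. nat (y j)" and ?\<alpha>' = "\<lambda>j. nat (- y j)"
  let ?up = "\<lambda>\<alpha> w j. if j \<in> {1..n} then w j + of_nat (\<alpha> j) else w j :: complex"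
  have up: "?up ?\<alpha> w = shift n k l lu v z \<longleftrightarrow> ?up ?\<alpha>' w = shift n k l lu v (z - b)" for w z
  proof -
    have "?up ?\<alpha> w j = shift n k l lu v z j \<longleftrightarrow> ?up ?\<alpha>' w j = shift n k l lu v (z - b) j" for j
    proof (cases "j \<in> {1..n}")
      case True
      have "(of_nat (nat (y j)) :: complex) - of_nat (nat (- y j)) = of_int (y j)"
        by (cases "y j \<ge> 0") auto
      then have "complex_of_nat (nat (y j)) = of_nat (nat (- y j)) + of_int b * cell j"
        by (simp add: y algebra_simps)
      then show ?thesis using True by (simp add: shift_def algebra_simps)
    qed (auto simp: shift_def ell_outside)
    then show ?thesis unfolding fun_eq_iff by blast
  qed
  have "fps_nth (lowering ?\<alpha> w * frob_series lu v (?up ?\<alpha> w)) s = fps_nth (lowering ?\<alpha>' w * frob_series lu v (?up ?\<alpha>' w)) s"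
    if "s \<le> r" for w s
  proof (cases "\<exists>z. ?up ?\<alpha> w = shift n k l lu v z")
    case True
    then obtain z where z: "?up ?\<alpha> w = shift n k l lu v z" by blast
    then have z': "?up ?\<alpha>' w = shift n k l lu v (z - b)" using up by blast
    have w: "w j + of_nat (?\<alpha> j) = shift n k l lu v z j"
      "w j + of_nat (?\<alpha>' j) = shift n k l lu v (z - b) j" if "j \<in> {1..n}" for j
      using fun_cong[OF z, of j] fun_cong[OF z', of j] that by auto
    have "s < m" using that \<open>r < m\<close> by simp
    consider "frob_coeff lu v z \<noteq> 0" | "frob_coeff lu v (z - b) \<noteq> 0" | "frob_coeff lu v z = 0" "frob_coeff lu v (z - b) = 0"
      by blast
    then have "fps_nth (lowering ?\<alpha> w * frob_coeff lu v z) s = fps_nth (lowering ?\<alpha>' w * frob_coeff lu v (z - b)) s"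
    proof cases
      case 1
      then show ?thesis using lowering_agree[OF lu min w] \<open>s < m\<close> by blast
    next
      case 2
      then show ?thesis using lowering_agree[OF lu min w(2,1)] \<open>s < m\<close> by metis
    qed simp
    then show ?thesis unfolding z z' frob_series_shift .
  next
    case False
    then have "?up ?\<alpha>' w \<noteq> shift n k l lu v z" for z
      using up[of w "z + b"] by simp
    with False show ?thesis
      by (subst (1 2) frob_series_eq_0) auto
  qed
  then have "logser r (\<lambda>w. lowering ?\<alpha> w * frob_series lu v (?up ?\<alpha> w)) =
      logser r (\<lambda>w. lowering ?\<alpha>' w * frob_series lu v (?up ?\<alpha>' w))"
    by (intro logser_cong)
  then show ?thesis
    by (simp add: box_op_def dpower_logser lowering_def)
qed

lemma is_solution_logser:
  assumes lu: "lu \<in> fibre n a u"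
    and min: "\<And>I. I \<subseteq> {1..n} \<Longrightarrow> card I \<ge> n - (m - 1) \<Longrightarrow> min_nsupp n a I u v"
    and "r < m"
  shows "is_solution n k a l (comb n a v + ovec u) (logser r (frob_series lu v))"
  unfolding is_solution_def
proof (intro conjI ballI allI)
  fix y assume "y \<in> rel_lattice n k l"
  then show "box_op n k l y (logser r (frob_series lu v)) = 0"
    using assms by (intro box_op_eq_0) auto
next
  fix i
  show "euler_op n k a l (comb n a v + ovec u) i (logser r (frob_series lu v)) = 0"
  proof (rule euler_op_eq_0)
    fix w q assume "logser r (frob_series lu v) w q \<noteq> 0"
    then have "frob_series lu v w \<noteq> 0" by (auto simp: logser_def split: if_splits)
    then obtain z where "w = shift n k l lu v z" using frob_series_eq_0 by blast
    then have "comb n a w = comb n a v + comb n a (\<lambda>j. complex_of_int (lu j + z * ell' j))"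
      by (simp only: shift_def comb_add)
    also have "comb n a (\<lambda>j. complex_of_int (lu j + z * ell' j)) = ovec u"
      using shift_in_fibre[OF lu, of z] by (subst comb_of_int) (simp add: fibre_def)
    finally show "comb n a w = comb n a v + ovec u" .
  qed
qed

lemma S_series_solution:
  assumes \<beta>: "\<beta> \<in> vec.span (ovec ` a ` {1..n})" and lu: "lu \<in> fibre n a u"
    and v: "v \<in> exponents' n k a l \<beta>"
    and min: "\<And>I. I \<subseteq> {1..n} \<Longrightarrow> card I \<ge> n - (log_mult k v - 1) \<Longrightarrow> min_nsupp n a I u v"
    and r: "r < log_mult k v"
  shows "is_solution n k a l (\<beta> + ovec u) (S_series n k l lu v r)"
  using is_solution_logser[OF lu min r] v
  unfolding S_series_eq_logser exponents'_iff[OF \<beta>] by auto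

section \<open>The Nilsson ring\<close>

lemma x0_fps_nth:
  "x0_fps n k l F (\<lambda>j. of_nat m * cell j) q = (if q = 0 then fps_nth F m else 0)"
proof -
  have "(\<lambda>j. of_nat m * cell j) = (\<lambda>j. of_nat m' * cell j) \<longleftrightarrow> m' = m" for m'
    using ell_nonzero[OF one_in(2)] by (auto dest: fun_cong[of _ _ 1])
  then show ?thesis by (simp add: x0_fps_def)
qed

lemma x0_fps_nth_0:
  assumes "\<And>m. w \<noteq> (\<lambda>j. of_nat m * cell j)"
  shows "x0_fps n k l F w q = 0"
  using assms by (simp add: x0_fps_def)

lemma one_nilsson: "mon 0 0 \<in> nilsson n k l E"
proof -
  have "x0_fps n k l 1 = mon 0 0"
  proof (intro ext)
    fix w q
    show "x0_fps n k l 1 w q = mon 0 0 w q"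
    proof (cases "\<exists>m. w = (\<lambda>j. of_nat m * cell j)")
      case True
      then obtain m where m: "w = (\<lambda>j. of_nat m * cell j)" by blast
      have "w = 0 \<longleftrightarrow> m = 0"
        using ell_nonzero[OF one_in(2)] by (auto simp: m fun_eq_iff dest: spec[of _ 1])
      then show ?thesis
        unfolding m x0_fps_nth by (auto simp: mon_def m)
    next
      case False
      moreover have "w \<noteq> 0" using False by (force intro: exI[of _ 0])
      ultimately show ?thesis by (simp add: x0_fps_nth_0 mon_def)
    qed
  qed
  then show ?thesis using nilsson.fps[of n k l 1 E] by simp
qed

lemma zero_nilsson: "0 \<in> nilsson n k l E"
proof -
  have "x0_fps n k l 0 = 0" by (auto simp: x0_fps_def fun_eq_iff)
  then show ?thesis using nilsson.fps[of n k l 0 E] by simp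
qed

lemma sum_nilsson: "(\<And>x. x \<in> A \<Longrightarrow> f x \<in> nilsson n k l E) \<Longrightarrow> sum f A \<in> nilsson n k l E"
  by (induction A rule: infinite_finite_induct) (auto intro: nilsson.add zero_nilsson)

lemma x0_power_nilsson: "mon (\<lambda>j. - of_nat N * cell j) 0 \<in> nilsson n k l E"
proof (induction N)
  case 0
  then show ?case using one_nilsson by (simp add: zero_fun_def)
next
  case (Suc N)
  have "smul (mon (\<lambda>j. - cell j) 0) (mon (\<lambda>j. - of_nat N * cell j) 0) = mon (\<lambda>j. - of_nat (Suc N) * cell j) 0"
    unfolding smul_mon_mon by (simp add: plus_fun_def algebra_simps)
  then show ?case using nilsson.mult[OF nilsson.x0_inverse Suc] by metis
qed

lemma log_power_nilsson: "mon 0 q \<in> nilsson n k l E"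
proof (induction q)
  case 0
  then show ?case by (rule one_nilsson)
next
  case (Suc q)
  have "mon 0 1 \<in> nilsson n k l E"
    using nilsson.log_x0[of n k l E] by (simp add: zero_fun_def)
  then show ?case
    using nilsson.mult[OF _ Suc, of "mon 0 1"] by (simp add: smul_mon_mon plus_1_eq_Suc)
qed

text \<open>
  Collecting the powers of the logarithm gives $x^v x_0^{-M} \sum_{q \le r} F_q(x_0) \log^q x_0$ with
  power series $F_q$.
\<close>

lemma logser_nilsson:
  assumes "v \<in> E"
    and supp: "\<And>w s. s \<le> r \<Longrightarrow> fps_nth (A w) s \<noteq> 0 \<Longrightarrow> \<exists>z\<ge>N. w = (\<lambda>j. v j + of_int z * cell j)"
  shows "logser r A \<in> nilsson n k l E"
proof -
  \<comment> \<open>The lower bound is rounded down to \<open>- M \<le> 0\<close>, so that only powers of the inverse of \<open>x\<^sub>0\<close> occur.\<close>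
  define M where "M = nat (- N)"
  define F where "F q = Abs_fps (\<lambda>m. fact r / fact q *
      fps_nth (A (\<lambda>j. v j + of_int (int m - int M) * cell j)) (r - q))" for q
  define T where "T q = smul (mon v 0) (smul (mon (\<lambda>j. - of_nat M * cell j) 0)
      (smul (mon 0 q) (x0_fps n k l (F q))))" for q
  have "logser r A = (\<Sum>q\<le>r. T q)"
  proof (intro ext)
    fix w q'
    let ?w = "w - v - (\<lambda>j. - of_nat M * cell j) - 0"
    have T: "T q w q' = (if q = q' then x0_fps n k l (F q) ?w 0 else 0)" for q
      by (auto simp: T_def smul_mon x0_fps_def)
    then have "(\<Sum>q\<le>r. T q) w q' = (if q' \<le> r then x0_fps n k l (F q') ?w 0 else 0)"
      by (simp add: sum_ser_nth)
    also have "\<dots> = logser r A w q'"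
    proof (cases "\<exists>m. ?w = (\<lambda>j. of_nat m * cell j)")
      case True
      then obtain m where m: "?w = (\<lambda>j. of_nat m * cell j)" by blast
      then have "w = (\<lambda>j. v j + of_int (int m - int M) * cell j)"
        by (auto simp: fun_eq_iff algebra_simps)
      then show ?thesis unfolding m x0_fps_nth by (simp add: F_def logser_def)
    next
      case False
      have "fps_nth (A w) s = 0" if "s \<le> r" for s
      proof (rule ccontr)
        assume "fps_nth (A w) s \<noteq> 0"
        then obtain z where z: "z \<ge> N" "w = (\<lambda>j. v j + of_int z * cell j)"
          using supp \<open>s \<le> r\<close> by blast
        have "complex_of_nat (nat (z + int M)) = of_int z + of_nat M"
          using z(1) by (simp add: M_def)
        then have "?w = (\<lambda>j. of_nat (nat (z + int M)) * cell j)"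
          by (simp add: z(2) fun_eq_iff algebra_simps)
        then show False using False by blast
      qed
      then show ?thesis using False by (simp add: x0_fps_nth_0 logser_def)
    qed
    finally show "logser r A w q' = (\<Sum>q\<le>r. T q) w q'" ..
  qed
  moreover have "(\<Sum>q\<le>r. T q) \<in> nilsson n k l E"
    unfolding T_def
    by (intro sum_nilsson nilsson.mult nilsson.exponent[OF assms(1)] x0_power_nilsson log_power_nilsson nilsson.fps)
  ultimately show ?thesis by simp
qed

text \<open>
  The support of the series lies in a half-line of $v + \ell^{(u)} + \mathbb{Z}\ell$. This coset has an
  integral $i$-th coordinate for every $i \in M_v$ and so contains an element of $E'_{\beta+u}$.
  Division by $x^{\ell^{(u)}}$ instead moves the support into $v + \mathbb{Z}\ell$.
\<close>

lemma S_series_nilsson: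
  assumes \<beta>: "\<beta> \<in> vec.span (ovec ` a ` {1..n})" and lu: "lu \<in> fibre n a u"
    and v: "v \<in> exponents' n k a l \<beta>" and r: "r < log_mult k v"
  shows "S_series n k l lu v r \<in> nilsson n k l (exponents' n k a l (\<beta> + ovec u))"
    and "S_series n k l lu v r \<in> smul (mon (\<lambda>j. of_int (lu j)) 0) ` nilsson n k l (exponents' n k a l \<beta>)"
proof -
  obtain N where N: "\<And>z s. s < log_mult k v \<Longrightarrow> fps_nth (frob_coeff lu v z) s \<noteq> 0 \<Longrightarrow> z \<ge> N"
    using frob_coeff_bounded_below[of v lu] by blast
  have supp: "\<exists>z\<ge>N. w = shift n k l lu v z" if "s \<le> r" "fps_nth (frob_series lu v w) s \<noteq> 0" for w s
  proof -
    have "frob_series lu v w \<noteq> 0" using that by auto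
    then obtain z where z: "w = shift n k l lu v z"
      using frob_series_eq_0[of w lu v] by blast
    then have "z \<ge> N"
      using N[of s z] that r by (simp add: frob_series_shift)
    then show ?thesis using z by blast
  qed
  have shift: "shift n k l lu v z = (\<lambda>j. (v j + of_int (lu j)) + of_int z * cell j)" for z
    by (simp add: shift_def add.assoc)
  have v': "v \<in> coords n" "comb n a v = \<beta>" using v unfolding exponents'_iff[OF \<beta>] by auto
  let ?w0 = "\<lambda>j. v j + complex_of_int (lu j)"
  have w0: "?w0 \<in> coords n" "comb n a ?w0 = \<beta> + ovec u"
    using v' lu by (auto simp: coords_def fibre_def comb_add comb_of_int)
  obtain i where i: "i \<in> {1..k}" "v i \<in> \<nat>" using log_mult_pos[OF v \<beta>] by blast
  then have "?w0 i \<in> \<int>" using Nats_subset_Ints by auto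
  from exists_exponent'_in_coset[OF w0(1) i(1) this]
  obtain c where c: "(\<lambda>j. ?w0 j + of_int c * cell j) \<in> exponents' n k a l (\<beta> + ovec u)"
    unfolding w0(2) by blast
  show "S_series n k l lu v r \<in> nilsson n k l (exponents' n k a l (\<beta> + ovec u))"
    unfolding S_series_eq_logser
  proof (rule logser_nilsson[OF c])
    fix w s assume "s \<le> r" "fps_nth (frob_series lu v w) s \<noteq> 0"
    then obtain z where z: "z \<ge> N" "w = shift n k l lu v z" using supp by blast
    then have "w = (\<lambda>j. ?w0 j + of_int c * cell j + of_int (z - c) * cell j)"
      by (simp add: shift algebra_simps)
    then show "\<exists>z\<ge>N - c. w = (\<lambda>j. ?w0 j + of_int c * cell j + of_int z * cell j)"
      using z(1) by (intro exI[of _ "z - c"]) auto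
  qed
  let ?lu = "\<lambda>j. complex_of_int (lu j)"
  let ?g = "logser r (\<lambda>w. frob_series lu v (w + ?lu))"
  have "?g \<in> nilsson n k l (exponents' n k a l \<beta>)"
  proof (rule logser_nilsson[OF v])
    fix w s assume "s \<le> r" "fps_nth (frob_series lu v (w + ?lu)) s \<noteq> 0"
    then obtain z where z: "z \<ge> N" "w + ?lu = shift n k l lu v z" using supp by blast
    then have "w = (\<lambda>j. v j + of_int z * cell j)"
      by (auto simp: shift fun_eq_iff algebra_simps)
    then show "\<exists>z\<ge>N. w = (\<lambda>j. v j + of_int z * cell j)" using z(1) by blast
  qed
  moreover have "S_series n k l lu v r = smul (mon ?lu 0) ?g"
    unfolding S_series_eq_logser by (intro ext) (simp add: smul_mon logser_def)
  ultimately show "S_series n k l lu v r \<in> smul (mon ?lu 0) ` nilsson n k l (exponents' n k a l \<beta>)"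
    by blast
qed

section \<open>Linear independence\<close>

lemma Phi_nonzero_imp_frob_coeff:
  assumes "Phi n k l lu v [] \<noteq> 0"
  shows "\<exists>z. fps_nth (frob_coeff lu v z) 0 \<noteq> 0"
proof (rule ccontr)
  assume *: "\<nexists>z. fps_nth (frob_coeff lu v z) 0 \<noteq> 0"
  have "Phi n k l lu v [] w q = 0" for w q
    using * by (auto simp: Phi_eq frob_coeff_def fps_prod_nth_0 gamma_ratio_nth intro!: sum.neutral)
  then show False using assms by (auto simp: fun_eq_iff)
qed

text \<open>
  The coefficient of $\log^r x_0$ in $S_{v,u,r}$ is $\Phi^\emptyset \neq 0$, and higher powers of
  the logarithm are absent. Ordered by $r$, the series of one $v$ are triangular; those of different
  $v$ live on different cosets of $\mathbb{Z}\ell$.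
\<close>

lemma S_series_independent:
  assumes \<beta>: "\<beta> \<in> vec.span (ovec ` a ` {1..n})"
    and nz: "\<And>v. v \<in> exponents' n k a l \<beta> \<Longrightarrow> Phi n k l lu v [] \<noteq> 0"
  defines "J \<equiv> SIGMA v:exponents' n k a l \<beta>. {..<log_mult k v}"
  shows "card ((\<lambda>(v, r). S_series n k l lu v r) ` J) = (\<Sum>i = 1..k. l i)"
    and "ser.independent ((\<lambda>(v, r). S_series n k l lu v r) ` J)"
proof -
  let ?f = "\<lambda>(v, r). S_series n k l lu v r"
  have "\<forall>v\<in>exponents' n k a l \<beta>. \<exists>z. fps_nth (frob_coeff lu v z) 0 \<noteq> 0"
    using Phi_nonzero_imp_frob_coeff nz by blast
  then obtain \<zeta> where \<zeta>: "\<And>v. v \<in> exponents' n k a l \<beta> \<Longrightarrow> fps_nth (frob_coeff lu v (\<zeta> v)) 0 \<noteq> 0"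
    by metis
  let ?w = "\<lambda>(v, r). shift n k l lu v (\<zeta> v)"
  have fin: "finite J" using finite_exponents'[of \<beta>] by (simp add: J_def)
  have diag: "?f x (?w x) (snd x) \<noteq> 0" if "x \<in> J" for x
    using that \<zeta> by (auto simp: J_def S_series_eq_logser logser_def frob_series_shift)
  have upper: "y = x \<or> snd x < snd y" if xy: "x \<in> J" "y \<in> J" "?f y (?w x) (snd x) \<noteq> 0" for x y
  proof -
    obtain v r v' r' where [simp]: "x = (v, r)" "y = (v', r')" by (cases x, cases y)
    have E: "v \<in> exponents' n k a l \<beta>" "v' \<in> exponents' n k a l \<beta>" using xy by (auto simp: J_def)
    have "r \<le> r'" "frob_series lu v' (shift n k l lu v (\<zeta> v)) \<noteq> 0"
      using xy(3) by (auto simp: S_series_eq_logser logser_def split: if_splits)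
    then obtain z where z: "shift n k l lu v (\<zeta> v) = shift n k l lu v' z"
      using frob_series_eq_0 by blast
    have "v' j = v j + of_int (\<zeta> v - z) * cell j" for j
      using fun_cong[OF z, of j] by (simp add: shift_def algebra_simps)
    then have "v' = v" by (rule exponents'_coset_unique[OF \<beta> E])
    then show ?thesis using \<open>r \<le> r'\<close> by auto
  qed
  note tri = triangular_family_independent[of J ?f ?w snd snd, OF fin diag upper]
  show "ser.independent (?f ` J)" by (rule tri(2))
  have "card (?f ` J) = card J" by (rule card_image[OF tri(1)])
  also have "\<dots> = (\<Sum>i = 1..k. l i)"
    using finite_exponents'[of \<beta>] by (simp add: J_def sum_log_mult[OF \<beta>])
  finally show "card (?f ` J) = (\<Sum>i = 1..k. l i)" .
qed

end

theorem corollary6p6: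
  fixes n k :: nat
    and a :: "nat \<Rightarrow> int ^ 'd"
    and l :: "nat \<Rightarrow> nat"
    and \<beta> :: "complex ^ 'd"
    and u :: "int ^ 'd"
    and lu :: "nat \<Rightarrow> int"
  assumes "codim_one n k a l"
    and "\<beta> \<in> vec.span (ovec ` a ` {1..n})"
    and "lu \<in> fibre n a u"
    and "\<And>v I. v \<in> exponents' n k a l \<beta> \<Longrightarrow> I \<subseteq> {1..n} \<Longrightarrow> card I \<ge> n - (log_mult k v - 1) \<Longrightarrow>
           min_nsupp n a I u v"
    and "\<And>v. v \<in> exponents' n k a l \<beta> \<Longrightarrow> Phi n k l lu v [] \<noteq> 0"
  shows "let \<S> = {S_series n k l lu v r | v r. v \<in> exponents' n k a l \<beta> \<and> r \<le> log_mult k v - 1}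
    in card \<S> = (\<Sum>i = 1..k. l i) \<and> ser.independent \<S> \<and>
       (\<forall>f \<in> \<S>. is_solution n k a l (\<beta> + ovec u) f \<and>
          f \<in> nilsson n k l (exponents' n k a l (\<beta> + ovec u)) \<and>
          f \<in> smul (mon (\<lambda>j. of_int (lu j)) 0) ` nilsson n k l (exponents' n k a l \<beta>))"
proof -
  interpret circuit n k a l by unfold_locales (rule assms(1))
  let ?J = "SIGMA v:exponents' n k a l \<beta>. {..<log_mult k v}"
  have r: "r \<le> log_mult k v - 1 \<longleftrightarrow> r < log_mult k v" if "v \<in> exponents' n k a l \<beta>" for v r
    using log_mult_pos(2)[OF that assms(2)] by auto
  have S: "{S_series n k l lu v r | v r. v \<in> exponents' n k a l \<beta> \<and> r \<le> log_mult k v - 1} =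
      (\<lambda>(v, r). S_series n k l lu v r) ` ?J"
    using r by (fastforce simp: image_iff)
  show ?thesis
    unfolding Let_def S
  proof (intro conjI ballI)
    show "card ((\<lambda>(v, r). S_series n k l lu v r) ` ?J) = (\<Sum>i = 1..k. l i)"
      "ser.independent ((\<lambda>(v, r). S_series n k l lu v r) ` ?J)"
      using S_series_independent[OF assms(2,5)] by auto
  next
    fix f assume "f \<in> (\<lambda>(v, r). S_series n k l lu v r) ` ?J"
    then obtain v r where vr: "v \<in> exponents' n k a l \<beta>" "r < log_mult k v" "f = S_series n k l lu v r"
      by auto
    show "is_solution n k a l (\<beta> + ovec u) f"
      unfolding vr(3) using assms(4)[OF vr(1)] by (intro S_series_solution[OF assms(2,3) vr(1) _ vr(2)]) auto
    show "f \<in> nilsson n k l (exponents' n k a l (\<beta> + ovec u))"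
      "f \<in> smul (mon (\<lambda>j. of_int (lu j)) 0) ` nilsson n k l (exponents' n k a l \<beta>)"
      unfolding vr(3) using S_series_nilsson[OF assms(2,3) vr(1,2)] by blast+
  qed
qed

end
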